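(* Let $\Bbbk$ be an algebraically closed field of characteristic $p>0$. Suppose $G$ is a closed subgroup of $\operatorname{GL}_2(\Bbbk)$ containing an infinite unipotent subgroup. Then $\delta(G)=\infty$.
   Context: A $G$-module is a finite-dimensional rational representation $V$ of the linear algebraic group $G$ over $\Bbbk$. $\Bbbk[V]\cong S(V^* )$ is the ring of polynomial functions on $V$, with $G$-action $(g\cdot f)(v)=f(g^{-1}v)$ and invariant ring $\Bbbk[V]^G$, graded by degree. $\Bbbk[V]^G_{\le d}$ is the set of invariants of degree at most $d$. For $S\subseteq \Bbbk[V]$, $S_+$ is the set of elements of $S$ with constant term zero. The nullcone $\mathcal{N}_{G,V}\subseteq V$ is the common zero set of $\Bbbk[V]^G_+$. A subset $S\subseteq\Bbbk[V]^G$ is a $\delta$-set if for every $v\in V^G\setminus\mathcal{N}_{G,V}$ there is $f\in S_+$ with $f(v)\neq 0$. Define $\delta(G,V)=\min\{d\ge 0 : \Bbbk[V]^G_{\le d}\text{ is a }\delta\text{-set}\}$ and $\delta(G)=\sup\{\delta(G,V): V\text{ a }G\text{-module}\}$ (equal to $\infty$ if unbounded). *)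

theory Defs
  imports
    "Jordan_Normal_Form.Determinant"
    "HOL-Computational_Algebra.Polynomial"
    "HOL-Library.Extended_Nat"
begin

definition GL :: "nat \<Rightarrow> 'k::field mat monoid" where
  "GL n = units_of (ring_mat TYPE('k) n ())"

text \<open>
  Polynomial functions of degree at most \<open>d\<close> on a set \<open>X\<close> with coordinate functions
  \<open>\<lambda>v. x v i\<close>, \<open>i \<in> I\<close> (\<open>I\<close> finite). Only the values on \<open>X\<close> matter. Over an infinite field a
  polynomial is determined by its values on affine space, so having some expression of degree at
  most \<open>d\<close> is the same as having degree at most \<open>d\<close>.
\<close>

definition poly_funs_le ::
  "'x set \<Rightarrow> 'i set \<Rightarrow> ('x \<Rightarrow> 'i \<Rightarrow> 'k::field) \<Rightarrow> nat \<Rightarrow> ('x \<Rightarrow> 'k) set" where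
  "poly_funs_le X I x d =
     {f. \<exists>A c. finite A \<and> (\<forall>\<alpha>\<in>A. (\<Sum>i\<in>I. \<alpha> i) \<le> d) \<and>
        (\<forall>v\<in>X. f v = (\<Sum>\<alpha>\<in>A. c \<alpha> * (\<Prod>i\<in>I. x v i ^ \<alpha> i)))}"

text \<open>The coordinate ring \<open>k[x\<^sub>i\<^sub>j, 1/det]\<close> of \<open>GL\<^sub>m\<close>.\<close>

definition regular_funs_GL :: "nat \<Rightarrow> ('k::field mat \<Rightarrow> 'k) set" where
  "regular_funs_GL m =
     {f. \<exists>d e. \<exists>P \<in> poly_funs_le (carrier_mat m m) ({..<m} \<times> {..<m}) ($$) d.
        \<forall>g\<in>carrier (GL m). f g = P g / det g ^ e}"

definition closed_subgroup_GL :: "nat \<Rightarrow> 'k::field mat set \<Rightarrow> bool" where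
  "closed_subgroup_GL m G \<longleftrightarrow>
     subgroup G (GL m) \<and>
     (\<exists>S \<subseteq> regular_funs_GL m. G = {g \<in> carrier (GL m). \<forall>f\<in>S. f g = 0})"

definition unipotent_mat :: "nat \<Rightarrow> 'k::field mat \<Rightarrow> bool" where
  "unipotent_mat m u \<longleftrightarrow>
     u \<in> carrier_mat m m \<and> (\<exists>e. (u - 1\<^sub>m m) ^\<^sub>m e = 0\<^sub>m m m)"

definition unipotent_subgroup_GL :: "nat \<Rightarrow> 'k::field mat set \<Rightarrow> bool" where
  "unipotent_subgroup_GL m U \<longleftrightarrow> subgroup U (GL m) \<and> (\<forall>u\<in>U. unipotent_mat m u)"

text \<open>
  A \<open>G\<close>-module of dimension \<open>n\<close>, for a closed subgroup \<open>G\<close> of \<open>GL\<^sub>m\<close>, is given in coordinates: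
  \<open>V = k\<^sup>n\<close> with \<open>G\<close> acting through \<open>\<rho>\<close>. Since \<open>G\<close> is closed, its regular functions are the
  restrictions of those on \<open>GL\<^sub>m\<close>.
\<close>

definition G_module :: "nat \<Rightarrow> 'k::field mat set \<Rightarrow> nat \<Rightarrow> ('k mat \<Rightarrow> 'k mat) \<Rightarrow> bool" where
  "G_module m G n \<rho> \<longleftrightarrow>
     \<rho> \<in> hom ((GL m)\<lparr>carrier := G\<rparr>) (GL n) \<and>
     (\<forall>i<n. \<forall>j<n. \<exists>f\<in>regular_funs_GL m. \<forall>g\<in>G. \<rho> g $$ (i, j) = f g)"

definition fixed_vecs :: "'k::field mat set \<Rightarrow> nat \<Rightarrow> ('k mat \<Rightarrow> 'k mat) \<Rightarrow> 'k vec set" where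
  "fixed_vecs G n \<rho> = {v \<in> carrier_vec n. \<forall>g\<in>G. \<rho> g *\<^sub>v v = v}"

definition invariants_le ::
  "nat \<Rightarrow> 'k::field mat set \<Rightarrow> nat \<Rightarrow> ('k mat \<Rightarrow> 'k mat) \<Rightarrow> nat \<Rightarrow> ('k vec \<Rightarrow> 'k) set" where
  "invariants_le m G n \<rho> d =
     {f \<in> poly_funs_le (carrier_vec n) {..<n} ($) d.
        \<forall>g\<in>G. \<forall>v\<in>carrier_vec n. f (\<rho> (inv\<^bsub>GL m\<^esub> g) *\<^sub>v v) = f v}"

definition invariants ::
  "nat \<Rightarrow> 'k::field mat set \<Rightarrow> nat \<Rightarrow> ('k mat \<Rightarrow> 'k mat) \<Rightarrow> ('k vec \<Rightarrow> 'k) set" where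
  "invariants m G n \<rho> = (\<Union>d. invariants_le m G n \<rho> d)"

text \<open>The constant term of a polynomial function is its value at the origin.\<close>

definition plus_part :: "nat \<Rightarrow> ('k::field vec \<Rightarrow> 'k) set \<Rightarrow> ('k vec \<Rightarrow> 'k) set" where
  "plus_part n S = {f \<in> S. f (0\<^sub>v n) = 0}"

definition nullcone ::
  "nat \<Rightarrow> 'k::field mat set \<Rightarrow> nat \<Rightarrow> ('k mat \<Rightarrow> 'k mat) \<Rightarrow> 'k vec set" where
  "nullcone m G n \<rho> =
     {v \<in> carrier_vec n. \<forall>f \<in> plus_part n (invariants m G n \<rho>). f v = 0}"

definition delta_set ::
  "nat \<Rightarrow> 'k::field mat set \<Rightarrow> nat \<Rightarrow> ('k mat \<Rightarrow> 'k mat) \<Rightarrow> ('k vec \<Rightarrow> 'k) set \<Rightarrow> bool" where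
  "delta_set m G n \<rho> S \<longleftrightarrow>
     S \<subseteq> invariants m G n \<rho> \<and>
     (\<forall>v \<in> fixed_vecs G n \<rho> - nullcone m G n \<rho>. \<exists>f \<in> plus_part n S. f v \<noteq> 0)"

text \<open>
  The infimum of naturals is a minimum: the zero sets of the \<open>plus_part\<close> of
  \<open>invariants_le m G n \<rho> d\<close> form a decreasing sequence of Zariski closed sets in \<open>d\<close>, which becomes
  constant, so some \<open>d\<close> always qualifies and the value is finite for every module.
\<close>

definition delta_module ::
  "nat \<Rightarrow> 'k::field mat set \<Rightarrow> nat \<Rightarrow> ('k mat \<Rightarrow> 'k mat) \<Rightarrow> enat" where
  "delta_module m G n \<rho> = Inf {enat d | d. delta_set m G n \<rho> (invariants_le m G n \<rho> d)}"

definition delta :: "nat \<Rightarrow> 'k::field mat set \<Rightarrow> enat" where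
  "delta m G = Sup {delta_module m G n \<rho> | n \<rho>. G_module m G n \<rho>}"

end

(*
  Let E be a finite additive subgroup of k with q > d elements such that, up to conjugation, the
  matrices [[1,t],[0,1]] with t in E lie in U. Let W be the space of binary forms of degree q - 1
  and let GL_2 act on V = End(W) by conjugation. The identity v is fixed, and det is an invariant
  with det(v) = 1. Restricted to E, the module W is the regular representation (polynomials of
  degree < q are functions on E), so for S <= E there is a projection P_S in V with P_E = v,
  P_{} = 0, and t P_S t^-1 = P_{S+t}. If f is an invariant of degree at most d, then
  sum_S (-1)^|S| f(P_S) = 0 because d < q. The summand is constant on orbits of the p-group E on
  subsets of E, so modulo p only the fixed points S = {} and S = E contribute, and f(0) = 0 forces
  f(v) = 0. Hence delta(G) > d.
*)
theory Submission
  imports Defs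
begin

section \<open>Polynomial functions\<close>

text \<open>The same module must serve every G between U and GL_2, including GL_2 itself, so the
  test vector has to be fixed by everything and still be seen by some invariant. Conjugation on
  End(W) achieves this: scalars act trivially, the identity is fixed, and det survives. The degree
  of the forms is dictated by interpolation: evaluation at the q points of E identifies polynomials
  of degree below q with functions on E, and the Lagrange polynomials give the coordinates in which
  the P_S are written down. Since det has degree q and does not vanish at v, one such module yields
  no bound beyond q; hence q itself has to grow, and this is where U being infinite enters. Positive
  characteristic acts twice: finitely generated subgroups of the additive group of k are finite, so
  E exists in arbitrarily large size, and sums over nontrivial orbits vanish. The vanishing of the
  alternating sum, in contrast, is pure combinatorics and rests on P_S being additive in S.\<close>

text \<open>The index set J may list the same exponent several times; coefficients belonging to
  equal exponents are collected. Sums and products can then be indexed by disjoint unions and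
  products of exponent sets, with no care for coincidences.\<close>

lemma poly_funs_leI:
  assumes "finite J" and deg: "\<And>j. j \<in> J \<Longrightarrow> (\<Sum>i\<in>I. b j i) \<le> d"
    and eq: "\<And>v. v \<in> X \<Longrightarrow> f v = (\<Sum>j\<in>J. c j * (\<Prod>i\<in>I. x v i ^ b j i))"
  shows "f \<in> poly_funs_le X I x d"
proof -
  define c' where "c' \<alpha> = (\<Sum>j\<in>{j \<in> J. b j = \<alpha>}. c j)" for \<alpha>
  have "f v = (\<Sum>\<alpha>\<in>b ` J. c' \<alpha> * (\<Prod>i\<in>I. x v i ^ \<alpha> i))" if "v \<in> X" for v
  proof -
    have "f v = (\<Sum>\<alpha>\<in>b ` J. \<Sum>j\<in>{j \<in> J. b j = \<alpha>}. c j * (\<Prod>i\<in>I. x v i ^ b j i))"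
      unfolding eq[OF that] by (rule sum.image_gen[OF \<open>finite J\<close>])
    also have "\<dots> = (\<Sum>\<alpha>\<in>b ` J. c' \<alpha> * (\<Prod>i\<in>I. x v i ^ \<alpha> i))"
      unfolding c'_def sum_distrib_right by (intro sum.cong refl) auto
    finally show ?thesis .
  qed
  moreover have "\<forall>\<alpha>\<in>b ` J. (\<Sum>i\<in>I. \<alpha> i) \<le> d"
    using deg by auto
  ultimately show ?thesis
    unfolding poly_funs_le_def using \<open>finite J\<close> by blast
qed

text \<open>For the regularity of a representation and for det as an invariant it is enough that
  some degree bound exists, so the bound is forgotten.\<close>

definition poly_funs :: "'x set \<Rightarrow> 'i set \<Rightarrow> ('x \<Rightarrow> 'i \<Rightarrow> 'k::field) \<Rightarrow> ('x \<Rightarrow> 'k) set" where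
  "poly_funs X I x = (\<Union>d. poly_funs_le X I x d)"

lemma poly_funs_const: "(\<lambda>_. c) \<in> poly_funs X I x"
proof -
  have "(\<lambda>_. c) \<in> poly_funs_le X I x 0"
    by (rule poly_funs_leI[where J = "{()}" and b = "\<lambda>_ _. 0" and c = "\<lambda>_. c"]) auto
  then show ?thesis unfolding poly_funs_def by blast
qed

lemma poly_funs_coord:
  assumes "finite I" "i \<in> I"
  shows "(\<lambda>v. x v i) \<in> poly_funs X I x"
proof -
  have "x v i = (\<Prod>j\<in>I. x v j ^ (if j = i then 1 else 0))" for v
    using assms by (subst prod.remove[of I i]) auto
  then have "(\<lambda>v. x v i) \<in> poly_funs_le X I x 1"
    using assms
    by (intro poly_funs_leI[where J = "{()}" and b = "\<lambda>_ j. if j = i then 1 else 0" and c = "\<lambda>_. 1"])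
      auto
  then show ?thesis unfolding poly_funs_def by blast
qed

lemma poly_funs_add:
  assumes "f \<in> poly_funs X I x" "g \<in> poly_funs X I x"
  shows "(\<lambda>v. f v + g v) \<in> poly_funs X I x"
proof -
  obtain d A a where f: "finite A" "\<forall>\<alpha>\<in>A. (\<Sum>i\<in>I. \<alpha> i) \<le> d"
    "\<forall>v\<in>X. f v = (\<Sum>\<alpha>\<in>A. a \<alpha> * (\<Prod>i\<in>I. x v i ^ \<alpha> i))"
    using assms(1) unfolding poly_funs_def poly_funs_le_def by blast
  obtain e B b where g: "finite B" "\<forall>\<beta>\<in>B. (\<Sum>i\<in>I. \<beta> i) \<le> e"
    "\<forall>v\<in>X. g v = (\<Sum>\<beta>\<in>B. b \<beta> * (\<Prod>i\<in>I. x v i ^ \<beta> i))"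
    using assms(2) unfolding poly_funs_def poly_funs_le_def by blast
  have "(\<lambda>v. f v + g v) \<in> poly_funs_le X I x (max d e)"
    by (rule poly_funs_leI[where J = "A <+> B" and b = "case_sum id id" and c = "case_sum a b"])
      (use f g in \<open>force simp: sum.Plus le_max_iff_disj\<close>)+
  then show ?thesis unfolding poly_funs_def by blast
qed

lemma poly_funs_mult:
  assumes "f \<in> poly_funs X I x" "g \<in> poly_funs X I x"
  shows "(\<lambda>v. f v * g v) \<in> poly_funs X I x"
proof -
  obtain d A a where f: "finite A" "\<forall>\<alpha>\<in>A. (\<Sum>i\<in>I. \<alpha> i) \<le> d"
    "\<forall>v\<in>X. f v = (\<Sum>\<alpha>\<in>A. a \<alpha> * (\<Prod>i\<in>I. x v i ^ \<alpha> i))"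
    using assms(1) unfolding poly_funs_def poly_funs_le_def by blast
  obtain e B b where g: "finite B" "\<forall>\<beta>\<in>B. (\<Sum>i\<in>I. \<beta> i) \<le> e"
    "\<forall>v\<in>X. g v = (\<Sum>\<beta>\<in>B. b \<beta> * (\<Prod>i\<in>I. x v i ^ \<beta> i))"
    using assms(2) unfolding poly_funs_def poly_funs_le_def by blast
  have "(\<lambda>v. f v * g v) \<in> poly_funs_le X I x (d + e)"
  proof (rule poly_funs_leI[where J = "A \<times> B" and b = "\<lambda>(\<alpha>, \<beta>) i. \<alpha> i + \<beta> i"
        and c = "\<lambda>(\<alpha>, \<beta>). a \<alpha> * b \<beta>"])
    show "finite (A \<times> B)" using f g by simp
    show "(\<Sum>i\<in>I. (case j of (\<alpha>, \<beta>) \<Rightarrow> \<lambda>i. \<alpha> i + \<beta> i) i) \<le> d + e" if "j \<in> A \<times> B" for j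
      using that f g by (auto simp: sum.distrib intro!: add_mono)
    show "f v * g v = (\<Sum>j\<in>A \<times> B. (case j of (\<alpha>, \<beta>) \<Rightarrow> a \<alpha> * b \<beta>) *
        (\<Prod>i\<in>I. x v i ^ (case j of (\<alpha>, \<beta>) \<Rightarrow> \<lambda>i. \<alpha> i + \<beta> i) i))" if "v \<in> X" for v
      using that f g
      by (auto simp: sum_product sum.cartesian_product power_add prod.distrib algebra_simps
          intro!: sum.cong)
  qed
  then show ?thesis unfolding poly_funs_def by blast
qed

lemma poly_funs_sum:
  assumes "\<And>j. j \<in> J \<Longrightarrow> f j \<in> poly_funs X I x"
  shows "(\<lambda>v. \<Sum>j\<in>J. f j v) \<in> poly_funs X I x"
  using assms
  by (induction J rule: infinite_finite_induct) (auto intro!: poly_funs_const poly_funs_add)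

lemma poly_funs_prod:
  assumes "\<And>j. j \<in> J \<Longrightarrow> f j \<in> poly_funs X I x"
  shows "(\<lambda>v. \<Prod>j\<in>J. f j v) \<in> poly_funs X I x"
  using assms
  by (induction J rule: infinite_finite_induct) (auto intro!: poly_funs_const poly_funs_mult)

text \<open>Here \<open>P v\<close> is a univariate polynomial whose coefficients vary polynomially
  with v. The entries of \<open>sym_power_mat\<close> are coefficients of products of powers of such
  polynomials.\<close>

lemma poly_funs_coeff_mult:
  assumes "\<And>j. (\<lambda>v. poly.coeff (P v) j) \<in> poly_funs X I x"
    and "\<And>j. (\<lambda>v. poly.coeff (Q v) j) \<in> poly_funs X I x"
  shows "(\<lambda>v. poly.coeff (P v * Q v) j) \<in> poly_funs X I x"
  unfolding coeff_mult by (intro poly_funs_sum poly_funs_mult assms)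

lemma poly_funs_coeff_power:
  assumes "\<And>j. (\<lambda>v. poly.coeff (P v) j) \<in> poly_funs X I x"
  shows "(\<lambda>v. poly.coeff (P v ^ n) j) \<in> poly_funs X I x"
proof (induction n arbitrary: j)
  case 0
  show ?case by (simp only: power_0 poly_funs_const)
next
  case (Suc n)
  show ?case unfolding power_Suc by (rule poly_funs_coeff_mult[OF assms Suc])
qed

lemma poly_funs_coeff_linear:
  assumes "f \<in> poly_funs X I x" "g \<in> poly_funs X I x"
  shows "(\<lambda>v. poly.coeff [:f v, g v:] j) \<in> poly_funs X I x"
proof -
  consider "j = 0" | "j = 1" | n where "j = Suc (Suc n)"
    by (metis One_nat_def nat.exhaust)
  then show ?thesis using assms by cases (auto simp: poly_funs_const)
qed

section \<open>Alternating sums over subsets\<close>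

text \<open>Toggling a point of E outside R flips the sign and does not affect whether S contains R,
  so the terms cancel in pairs.\<close>

lemma alternating_sum_Pow_superset:
  fixes E R :: "'a set"
  assumes "finite E" "\<not> E \<subseteq> R"
  shows "(\<Sum>S\<in>Pow E. (-1) ^ card S * of_bool (R \<subseteq> S)) = (0 :: 'b::comm_ring_1)"
proof -
  obtain e where e: "e \<in> E" "e \<notin> R" using assms(2) by blast
  let ?h = "\<lambda>S. (-1) ^ card S * of_bool (R \<subseteq> S) :: 'b"
  have fin: "finite S" if "S \<in> Pow (E - {e})" for S
    using that assms(1) by (auto intro: finite_subset)
  have "Pow E = Pow (E - {e}) \<union> insert e ` Pow (E - {e})"
    using Pow_insert[of e "E - {e}"] e(1) by (simp add: insert_absorb)
  then have "sum ?h (Pow E) = sum ?h (Pow (E - {e})) + sum ?h (insert e ` Pow (E - {e}))"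
    using assms(1) by (simp only:) (rule sum.union_disjoint, auto)
  also have "sum ?h (insert e ` Pow (E - {e})) = (\<Sum>S\<in>Pow (E - {e}). ?h (insert e S))"
    by (subst sum.reindex) (auto simp: inj_on_def)
  also have "\<dots> = (\<Sum>S\<in>Pow (E - {e}). - ?h S)"
  proof (rule sum.cong[OF refl])
    fix S assume S: "S \<in> Pow (E - {e})"
    moreover have "R \<subseteq> insert e S \<longleftrightarrow> R \<subseteq> S" using e by blast
    moreover have "card (insert e S) = Suc (card S)"
      using S fin[OF S] by (subst card_insert_disjoint) auto
    ultimately show "?h (insert e S) = - ?h S" by simp
  qed
  finally show ?thesis by (simp add: sum_negf)
qed

text \<open>Each factor is a sum over e in E of \<open>a m e\<close> times the indicator of e in S,
  and this indicator is absorbed into R. Every factor enlarges R by at most one point, so after all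
  of them R is still too small to contain E.\<close>

lemma alternating_sum_Pow_prod_list:
  fixes a :: "'m \<Rightarrow> 'a \<Rightarrow> 'b::comm_ring_1"
  assumes "finite E" "finite R" "card R + length ms < card E"
  shows "(\<Sum>S\<in>Pow E. (-1) ^ card S * of_bool (R \<subseteq> S) * prod_list (map (\<lambda>m. \<Sum>e\<in>S. a m e) ms)) = 0"
  using assms(2,3)
proof (induction ms arbitrary: R)
  case Nil
  then have "\<not> E \<subseteq> R" using card_mono[of R E] by auto
  then show ?case using alternating_sum_Pow_superset[OF assms(1)] by simp
next
  case (Cons m ms)
  let ?p = "\<lambda>S. prod_list (map (\<lambda>m. \<Sum>e\<in>S. a m e) ms)"
  have "(\<Sum>S\<in>Pow E. (-1) ^ card S * of_bool (R \<subseteq> S) * prod_list (map (\<lambda>m. \<Sum>e\<in>S. a m e) (m # ms)))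
    = (\<Sum>S\<in>Pow E. \<Sum>e\<in>E. a m e * ((-1) ^ card S * of_bool (insert e R \<subseteq> S) * ?p S))"
  proof (rule sum.cong[OF refl])
    fix S assume "S \<in> Pow E"
    then have "(\<Sum>e\<in>S. a m e) = (\<Sum>e\<in>E. a m e * of_bool (e \<in> S))"
      using assms(1) by (intro sum.mono_neutral_cong_left) auto
    then show "(-1) ^ card S * of_bool (R \<subseteq> S) * prod_list (map (\<lambda>m. \<Sum>e\<in>S. a m e) (m # ms))
      = (\<Sum>e\<in>E. a m e * ((-1) ^ card S * of_bool (insert e R \<subseteq> S) * ?p S))"
      by (simp add: sum_distrib_left sum_distrib_right ac_simps of_bool_conj)
  qed
  also have "\<dots> = (\<Sum>e\<in>E. a m e * (\<Sum>S\<in>Pow E. (-1) ^ card S * of_bool (insert e R \<subseteq> S) * ?p S))"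
    by (subst sum.swap) (simp only: sum_distrib_left)
  also have "\<dots> = 0"
  proof (rule sum.neutral, rule ballI)
    fix e assume "e \<in> E"
    have "card (insert e R) + length ms < card E"
      using Cons.prems card_insert_le_m1[of "Suc (card R)" R e] by simp
    then show "a m e * (\<Sum>S\<in>Pow E. (-1) ^ card S * of_bool (insert e R \<subseteq> S) * ?p S) = 0"
      using Cons.IH[of "insert e R"] Cons.prems by simp
  qed
  finally show ?case .
qed

text \<open>The monomial is spelled out as its list of variables with multiplicity. The list is
  chosen before y, so one list serves all points of evaluation.\<close>

lemma prod_power_eq_prod_list:
  fixes \<alpha> :: "'i \<Rightarrow> nat"
  assumes "finite I"
  obtains ms where "length ms = (\<Sum>i\<in>I. \<alpha> i)"
    "\<And>y :: 'i \<Rightarrow> 'b::comm_monoid_mult. prod_list (map y ms) = (\<Prod>i\<in>I. y i ^ \<alpha> i)"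
proof -
  have "\<exists>ms. length ms = (\<Sum>i\<in>I. \<alpha> i) \<and>
    (\<forall>y :: 'i \<Rightarrow> 'b. prod_list (map y ms) = (\<Prod>i\<in>I. y i ^ \<alpha> i))"
    using assms
  proof (induction I)
    case (insert i I)
    then obtain ms where "length ms = (\<Sum>i\<in>I. \<alpha> i)"
      "\<forall>y :: 'i \<Rightarrow> 'b. prod_list (map y ms) = (\<Prod>i\<in>I. y i ^ \<alpha> i)"
      by blast
    with insert show ?case
      by (intro exI[of _ "replicate (\<alpha> i) i @ ms"]) auto
  qed auto
  then show ?thesis using that by blast
qed

text \<open>
  A polynomial of degree \<open>d\<close> in linear forms \<open>S \<mapsto> \<Sum>e\<in>S. a i e\<close> is a combination of the
  functions \<open>S \<mapsto> [R \<subseteq> S]\<close> with \<open>card R \<le> d\<close>, each of which has vanishing alternating sum.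
\<close>

lemma alternating_sum_Pow_poly_fun:
  fixes y :: "'a set \<Rightarrow> 'x" and x :: "'x \<Rightarrow> 'i \<Rightarrow> 'k::field"
  assumes f: "f \<in> poly_funs_le X I x d" and "finite I" and "finite E" and "d < card E"
    and y: "\<And>S. S \<subseteq> E \<Longrightarrow> y S \<in> X"
    and lin: "\<And>S i. S \<subseteq> E \<Longrightarrow> i \<in> I \<Longrightarrow> x (y S) i = (\<Sum>e\<in>S. a i e)"
  shows "(\<Sum>S\<in>Pow E. (-1) ^ card S * f (y S)) = 0"
proof -
  obtain A c where A: "finite A" "\<And>\<alpha>. \<alpha> \<in> A \<Longrightarrow> (\<Sum>i\<in>I. \<alpha> i) \<le> d"
    and fv: "\<And>v. v \<in> X \<Longrightarrow> f v = (\<Sum>\<alpha>\<in>A. c \<alpha> * (\<Prod>i\<in>I. x v i ^ \<alpha> i))"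
    using f unfolding poly_funs_le_def by blast
  have "(\<Sum>S\<in>Pow E. (-1) ^ card S * f (y S))
    = (\<Sum>S\<in>Pow E. \<Sum>\<alpha>\<in>A. c \<alpha> * ((-1) ^ card S * (\<Prod>i\<in>I. (\<Sum>e\<in>S. a i e) ^ \<alpha> i)))"
    by (intro sum.cong refl) (auto simp: fv y lin sum_distrib_left ac_simps)
  also have "\<dots> = (\<Sum>\<alpha>\<in>A. c \<alpha> * (\<Sum>S\<in>Pow E. (-1) ^ card S * (\<Prod>i\<in>I. (\<Sum>e\<in>S. a i e) ^ \<alpha> i)))"
    by (subst sum.swap) (simp only: sum_distrib_left)
  also have "\<dots> = 0"
  proof (rule sum.neutral, rule ballI)
    fix \<alpha> assume \<alpha>: "\<alpha> \<in> A"
    obtain ms where ms: "length ms = (\<Sum>i\<in>I. \<alpha> i)"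
      "\<And>y :: 'i \<Rightarrow> 'k. prod_list (map y ms) = (\<Prod>i\<in>I. y i ^ \<alpha> i)"
      using prod_power_eq_prod_list[OF \<open>finite I\<close>, where \<alpha> = \<alpha>] by blast
    have "(\<Sum>S\<in>Pow E. (-1) ^ card S * (\<Prod>i\<in>I. (\<Sum>e\<in>S. a i e) ^ \<alpha> i)) = 0"
      using alternating_sum_Pow_prod_list[of E "{}" ms a] A(2)[OF \<alpha>] assms(3,4) ms by simp
    then show "c \<alpha> * (\<Sum>S\<in>Pow E. (-1) ^ card S * (\<Prod>i\<in>I. (\<Sum>e\<in>S. a i e) ^ \<alpha> i)) = 0"
      by simp
  qed
  finally show ?thesis .
qed

section \<open>Sums invariant under translations in characteristic p\<close>

text \<open>The map s generates an action of the cyclic group of order p on X, whose orbits have 1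
  or p elements. On an orbit of size p the constant F sums to p times a value, which is 0.\<close>

lemma sum_eq_sum_fixpoints_CHAR:
  fixes F :: "'a \<Rightarrow> 'b::comm_ring_1"
  assumes "prime p" and char: "of_nat p = (0 :: 'b)" and "finite X"
    and X: "\<And>x. x \<in> X \<Longrightarrow> s x \<in> X"
    and per: "\<And>x. x \<in> X \<Longrightarrow> (s ^^ p) x = x"
    and inv: "\<And>x. x \<in> X \<Longrightarrow> F (s x) = F x"
  shows "sum F X = sum F {x \<in> X. s x = x}"
proof -
  define Y where "Y = {x \<in> X. s x \<noteq> x}"
  define orb where "orb x = (\<lambda>i. (s ^^ i) x) ` {..<p}" for x
  have p: "p > 1" using \<open>prime p\<close> prime_gt_1_nat by blast
  have iter_X: "(s ^^ i) x \<in> X" if "x \<in> X" for x i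
    using that by (induction i) (auto intro: X)
  have per_mult: "(s ^^ (k * p)) x = x" if "x \<in> X" for x k
    using that by (induction k) (auto simp: funpow_add per)
  have F_iter: "F ((s ^^ i) x) = F x" if "x \<in> X" for x i
    using that by (induction i) (auto simp: inv iter_X)
  have no_fix: "(s ^^ m) x \<noteq> x" if x: "x \<in> Y" and m: "0 < m" "m < p" for x m
  proof
    assume fix_m: "(s ^^ m) x = x"
    have "coprime m p"
      using m \<open>prime p\<close> by (metis coprime_commute nat_dvd_not_less prime_imp_coprime)
    \<comment> \<open>Bezout: a point fixed by both the m-th and the p-th iterate is fixed by s
      itself.\<close>
    then obtain a b where "a * m = b * p + 1"
      using m bezout_nat[of m p] by (metis coprime_imp_gcd_eq_1 mult.commute not_gr_zero)
    moreover have "(s ^^ (a * m)) x = x"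
      using fix_m by (induction a) (auto simp: funpow_add)
    moreover have "(s ^^ (b * p + 1)) x = s x"
      using x per_mult[of "s x" b] X by (simp only: funpow_add) (auto simp: Y_def)
    ultimately show False using x unfolding Y_def by simp
  qed
  have iter_Y: "(s ^^ i) x \<in> Y" if x: "x \<in> Y" for x i
  proof -
    have xX: "x \<in> X" using x by (simp add: Y_def)
    have "s ((s ^^ i) x) \<noteq> (s ^^ i) x"
    proof
      assume eq: "s ((s ^^ i) x) = (s ^^ i) x"
      have "(s ^^ k) ((s ^^ i) x) = (s ^^ i) x" for k
        by (induction k) (simp_all add: eq)
      \<comment> \<open>Topped up by these exponents, the i-th iterate becomes the iterates of order
        \<open>i * p\<close> and \<open>i * p + 1\<close>, which send x to x and to
        \<open>s x\<close>.\<close>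
      from this[of "i * p - i"] this[of "Suc (i * p - i)"]
      have "(s ^^ (i * p - i + i)) x = (s ^^ Suc (i * p - i + i)) x"
        by (simp add: funpow_add)
      moreover have "i * p - i + i = i * p" using p by simp
      ultimately show False using x per_mult[OF xX, of i] by (simp add: Y_def)
    qed
    then show ?thesis using iter_X[OF xX] by (simp add: Y_def)
  qed
  have orb_s: "orb (s x) = orb x" if x: "x \<in> X" for x
  proof -
    have "orb (s x) = (\<lambda>i. (s ^^ i) x) ` Suc ` {..<p}"
      unfolding orb_def image_image by (simp add: funpow_swap1)
    also have "Suc ` {..<p} = insert p {1..<p}"
      using p by (auto simp: image_Suc_lessThan)
    also have "(\<lambda>i. (s ^^ i) x) ` insert p {1..<p} = (\<lambda>i. (s ^^ i) x) ` insert 0 {1..<p}"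
      using per[OF x] by simp
    also have "insert 0 {1..<p} = {..<p}" using p by auto
    finally show ?thesis unfolding orb_def .
  qed
  have orb_iter: "orb ((s ^^ i) x) = orb x" if "x \<in> X" for x i
    using that by (induction i) (auto simp: orb_s iter_X)
  have self: "x \<in> orb x" for x
    unfolding orb_def using p by (intro image_eqI[of _ _ 0]) auto
  have orb_class: "{x \<in> Y. orb x = orb y} = orb y" if y: "y \<in> Y" for y
  proof (intro equalityI subsetI)
    fix x assume "x \<in> orb y"
    then obtain i where i: "x = (s ^^ i) y" unfolding orb_def by blast
    show "x \<in> {x \<in> Y. orb x = orb y}"
      using iter_Y[OF y] orb_iter[of y] y unfolding i by (simp add: Y_def)
  qed (use self in auto)
  have "sum F (orb y) = 0" if y: "y \<in> Y" for y
  proof -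
    have yX: "y \<in> X" using y by (simp add: Y_def)
    have "inj_on (\<lambda>i. (s ^^ i) y) {..<p}"
    proof (rule linorder_inj_onI)
      fix i j assume ij: "i < j" "i \<in> {..<p}" "j \<in> {..<p}"
      show "(s ^^ i) y \<noteq> (s ^^ j) y"
      proof
        assume "(s ^^ i) y = (s ^^ j) y"
        moreover have "(s ^^ j) y = (s ^^ (j - i)) ((s ^^ i) y)"
          using ij by (simp flip: funpow_add[unfolded o_def, THEN fun_cong])
        ultimately have "(s ^^ (j - i)) ((s ^^ i) y) = (s ^^ i) y" by simp
        then show False using no_fix[OF iter_Y[OF y], of "j - i" i] ij by (simp add: less_imp_diff_less)
      qed
    qed auto
    then have "card (orb y) = p" unfolding orb_def by (simp add: card_image)
    moreover have "sum F (orb y) = (\<Sum>_\<in>orb y. F y)"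
      by (intro sum.cong refl) (auto simp: orb_def F_iter yX)
    ultimately show ?thesis by (simp add: char)
  qed
  moreover have "finite Y" unfolding Y_def using \<open>finite X\<close> by simp
  ultimately have "sum F Y = 0"
    unfolding sum.image_gen[OF \<open>finite Y\<close>, of F orb] by (intro sum.neutral) (auto simp: orb_class)
  moreover have "sum F X = sum F {x \<in> X. s x = x} + sum F Y"
    unfolding Y_def using \<open>finite X\<close> by (subst sum.union_disjoint[symmetric]) (auto intro!: sum.cong)
  ultimately show ?thesis by simp
qed

text \<open>Each single translation has order dividing p, and translations commute, so one can
  restrict the sum to the fixed sets of one translation after another. A nonempty subset fixed by
  all of them is E, because E acts transitively on itself.\<close>

lemma sum_shift_invariant_Pow_CHAR:
  fixes E :: "'k::field set" and F :: "'k set \<Rightarrow> 'k"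
  assumes "CHAR('k) > 0" and "finite E" and "E \<noteq> {}"
    and add: "\<And>s t. s \<in> E \<Longrightarrow> t \<in> E \<Longrightarrow> s + t \<in> E"
    and inv: "\<And>S t. S \<subseteq> E \<Longrightarrow> t \<in> E \<Longrightarrow> F ((\<lambda>e. e + t) ` S) = F S"
  shows "sum F (Pow E) = F {} + F E"
proof -
  let ?p = "CHAR('k)"
  let ?sh = "\<lambda>t S. (\<lambda>e. e + t) ` S"
  have "prime ?p" using prime_CHAR_semidom[where ?'a = 'k] assms(1) by blast
  have iter: "(?sh t ^^ n) S = ?sh (of_nat n * t) S" for t n S
    by (induction n) (auto simp: image_image algebra_simps)
  have step: "sum F (Pow E) = sum F {S \<in> Pow E. \<forall>t\<in>D. ?sh t S = S}" if "D \<subseteq> E" for D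
    using finite_subset[OF that \<open>finite E\<close>] that
  proof (induction D rule: finite_induct)
    case (insert t D)
    let ?X = "{S \<in> Pow E. \<forall>t\<in>D. ?sh t S = S}"
    have "sum F ?X = sum F {S \<in> ?X. ?sh t S = S}"
    proof (rule sum_eq_sum_fixpoints_CHAR[OF \<open>prime ?p\<close>])
      show "finite ?X" using \<open>finite E\<close> by simp
      fix S assume S: "S \<in> ?X"
      have "?sh r (?sh t S) = ?sh t S" if "r \<in> D" for r
      proof -
        have "?sh r (?sh t S) = ?sh t (?sh r S)" by (simp add: image_image add_ac)
        then show ?thesis using S that by simp
      qed
      then show "?sh t S \<in> ?X" using S insert.prems add by auto
      show "(?sh t ^^ ?p) S = S" unfolding iter by simp
      show "F (?sh t S) = F S" using inv S insert.prems by auto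
    qed auto
    also have "{S \<in> ?X. ?sh t S = S} = {S \<in> Pow E. \<forall>t\<in>insert t D. ?sh t S = S}" by auto
    finally show ?case using insert by simp
  qed (simp add: Pow_def)
  \<comment> \<open>Closure under addition gives one inclusion; translation is injective, so equal
    finite cardinalities give the other.\<close>
  have shift_E: "?sh t E = E" if "t \<in> E" for t
    using that add \<open>finite E\<close> by (intro card_subset_eq) (auto simp: card_image)
  have "{S \<in> Pow E. \<forall>t\<in>E. ?sh t S = S} = {{}, E}"
  proof (intro equalityI subsetI)
    fix S assume S: "S \<in> {S \<in> Pow E. \<forall>t\<in>E. ?sh t S = S}"
    show "S \<in> {{}, E}"
    proof (cases "S = {}")
      case False
      then obtain x where x: "x \<in> S" by blast
      have "y \<in> S" if y: "y \<in> E" for y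
      proof -
        obtain t where "t \<in> E" "y = t + x" using shift_E[of x] x S y by blast
        then show ?thesis using S x by (force simp: add.commute)
      qed
      then show ?thesis using S by blast
    qed simp
  qed (use shift_E in auto)
  then show ?thesis using step[of E] \<open>E \<noteq> {}\<close> by simp
qed

text \<open>Adjoining t to E means passing to E + F_p t, which stays finite because multiples of t
  depend only on the factor modulo p.\<close>

lemma finite_additive_subset_card_ge:
  fixes T :: "'k::field set"
  assumes "CHAR('k) > 0" and "infinite T" and T0: "0 \<in> T"
    and T: "\<And>s t. s \<in> T \<Longrightarrow> t \<in> T \<Longrightarrow> s + t \<in> T"
  obtains E where "finite E" "E \<subseteq> T" "n < card E" "\<And>s t. s \<in> E \<Longrightarrow> t \<in> E \<Longrightarrow> s + t \<in> E"
proof -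
  let ?p = "CHAR('k)"
  have mult: "of_nat i * t \<in> T" if "t \<in> T" for i t
    using that by (induction i) (auto simp: algebra_simps T0 T)
  have "\<exists>E. finite E \<and> E \<subseteq> T \<and> n < card E \<and> (\<forall>s\<in>E. \<forall>t\<in>E. s + t \<in> E)"
  proof (induction n)
    case 0
    show ?case by (rule exI[of _ "{0}"]) (simp add: T0)
  next
    case (Suc n)
    then obtain E where E: "finite E" "E \<subseteq> T" "n < card E" "\<And>s t. s \<in> E \<Longrightarrow> t \<in> E \<Longrightarrow> s + t \<in> E"
      by blast
    obtain t where t: "t \<in> T" "t \<notin> E" using E(1) \<open>infinite T\<close> by (meson finite_subset subsetI)
    have E0: "0 \<in> E"
    proof -
      obtain e where e: "e \<in> E" using E(3) by (metis card.empty equals0I not_less_zero)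
      have "of_nat (Suc i) * e \<in> E" for i
      proof (induction i)
        case (Suc i)
        then have "e + of_nat (Suc i) * e \<in> E" using e E(4) by blast
        then show ?case by (simp add: algebra_simps)
      qed (use e in simp)
      \<comment> \<open>Adding e to itself p times gives 0. With 0 in E, the set \<open>E'\<close>
        below really contains t.\<close>
      from this[of "?p - 1"] show ?thesis using assms(1) by simp
    qed
    define E' where "E' = (\<lambda>(e, i). e + of_nat i * t) ` (E \<times> {..<?p})"
    have E'I: "e + of_nat i * t \<in> E'" if "e \<in> E" for e i
    proof -
      have "(of_nat i :: 'k) = of_nat (i mod ?p)"
      proof -
        have "(of_nat i :: 'k) = of_nat (?p * (i div ?p) + i mod ?p)"
          by (simp only: mult_div_mod_eq)
        also have "\<dots> = of_nat (i mod ?p)"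
          by (simp only: of_nat_add of_nat_mult of_nat_CHAR mult_zero_left add_0_left)
        finally show ?thesis .
      qed
      then show ?thesis unfolding E'_def using that assms(1)
        by (intro image_eqI[of _ _ "(e, i mod ?p)"]) auto
    qed
    have "insert t E \<subseteq> E'" using E'I[of 0 1] E'I[of _ 0] E0 by auto
    moreover have fin: "finite E'" unfolding E'_def using E(1) by simp
    ultimately have "card (insert t E) \<le> card E'" by (intro card_mono)
    then have "Suc n < card E'" using E(1,3) t by simp
    moreover have "E' \<subseteq> T" unfolding E'_def using E(2) t mult T by auto
    moreover have "r + s \<in> E'" if rs: "r \<in> E'" "s \<in> E'" for r s
    proof -
      obtain e i e' j where "r = e + of_nat i * t" "s = e' + of_nat j * t" "e \<in> E" "e' \<in> E"
        using rs unfolding E'_def by auto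
      then show ?thesis using E'I[of "e + e'" "i + j"] E(4) by (simp add: algebra_simps)
    qed
    ultimately show ?case using fin by blast
  qed
  then show ?thesis using that by blast
qed

section \<open>Symmetric powers of two-by-two matrices\<close>

text \<open>
  The matrix of \<open>g\<close> on binary forms of degree \<open>N\<close>, dehomogenised: row \<open>i\<close> lists the coefficients
  of the image of \<open>X\<^sup>i Y\<^sup>N\<^sup>-\<^sup>i\<close> at \<open>Y = 1\<close>.
\<close>

definition sym_power_mat :: "nat \<Rightarrow> 'k::field mat \<Rightarrow> 'k mat" where
  "sym_power_mat N g = mat (Suc N) (Suc N)
     (\<lambda>(i, j). poly.coeff ([:g $$ (0,1), g $$ (0,0):] ^ i * [:g $$ (1,1), g $$ (1,0):] ^ (N - i)) j)"

text \<open>This is Y^N P(X/Y) with denominators cleared: the degree-N homogenisation of P,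
  evaluated at a pair of polynomials.\<close>

definition homog_eval :: "nat \<Rightarrow> 'k::comm_ring_1 poly \<Rightarrow> 'k poly \<Rightarrow> 'k poly \<Rightarrow> 'k poly" where
  "homog_eval N P X Y = (\<Sum>j\<le>N. smult (poly.coeff P j) (X ^ j * Y ^ (N - j)))"

text \<open>Homogenisation is multiplicative as long as the level rises with the degree. The bound
  on \<open>degree P\<close> removes the top term in the part carrying b; the part carrying a is an
  index shift.\<close>

lemma homog_eval_linear_mult:
  assumes "degree P \<le> N"
  shows "homog_eval (Suc N) ([:b, a:] * P) X Y = (smult a X + smult b Y) * homog_eval N P X Y"
proof -
  have "homog_eval (Suc N) ([:b, a:] * P) X Y
    = (\<Sum>j\<le>Suc N. smult (b * poly.coeff P j) (X ^ j * Y ^ (Suc N - j)))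
      + (\<Sum>j\<le>Suc N. smult (poly.coeff (pCons 0 (smult a P)) j) (X ^ j * Y ^ (Suc N - j)))"
    unfolding homog_eval_def by (simp add: smult_add_left sum.distrib)
  also have "(\<Sum>j\<le>Suc N. smult (b * poly.coeff P j) (X ^ j * Y ^ (Suc N - j)))
    = (\<Sum>j\<le>N. smult (b * poly.coeff P j) (X ^ j * Y ^ (Suc N - j)))"
    using assms by (simp add: coeff_eq_0)
  also have "\<dots> = smult b Y * homog_eval N P X Y"
    unfolding homog_eval_def sum_distrib_left
    by (intro sum.cong refl) (simp add: Suc_diff_le algebra_simps)
  also have "(\<Sum>j\<le>Suc N. smult (poly.coeff (pCons 0 (smult a P)) j) (X ^ j * Y ^ (Suc N - j)))
    = smult a X * homog_eval N P X Y"
    unfolding homog_eval_def sum_distrib_left sum.atMost_Suc_shift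
    by (simp add: algebra_simps)
  finally show ?thesis by (simp add: algebra_simps)
qed

lemma degree_linear_powers_le:
  "degree ([:b, a:] ^ i * [:d, c:] ^ m) \<le> i + m"
proof -
  have "degree ([:b, a:] ^ i) \<le> i" "degree ([:d, c:] ^ m) \<le> m"
    using degree_power_le[of "[:b, a:]" i] degree_power_le[of "[:d, c:]" m]
    by (auto intro: order_trans split: if_splits)
  then show ?thesis using degree_mult_le[of "[:b, a:] ^ i" "[:d, c:] ^ m"] by linarith
qed

lemma homog_eval_linear_powers:
  "homog_eval (i + m) ([:b, a:] ^ i * [:d, c:] ^ m) X Y
    = (smult a X + smult b Y) ^ i * (smult c X + smult d Y) ^ m"
proof (induction i)
  case 0
  show ?case
  proof (induction m)
    case 0
    show ?case by (simp add: homog_eval_def)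
  next
    case (Suc m)
    then show ?case
      using homog_eval_linear_mult[of "[:d, c:] ^ m" m d c X Y] degree_linear_powers_le[of 0 0 0 d c m]
      by simp
  qed
next
  case (Suc i)
  then show ?case
    using homog_eval_linear_mult[of "[:b, a:] ^ i * [:d, c:] ^ m" "i + m" b a X Y]
      degree_linear_powers_le[of b a i d c m]
    by (simp add: mult.assoc del: mult_pCons_left)
qed

lemma sym_power_mat_carrier [simp]: "sym_power_mat N g \<in> carrier_mat (Suc N) (Suc N)"
  unfolding sym_power_mat_def by simp

lemma sym_power_mat_dim [simp]:
  "dim_row (sym_power_mat N g) = Suc N" "dim_col (sym_power_mat N g) = Suc N"
  unfolding sym_power_mat_def by simp_all

lemma mult_mat_2_index:
  assumes "g \<in> carrier_mat 2 2" "h \<in> carrier_mat 2 2" "i < 2" "j < 2"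
  shows "(g * h) $$ (i, j) = g $$ (i, 0) * h $$ (0, j) + g $$ (i, 1) * h $$ (1, j)"
  using assms by (auto simp: scalar_prod_def numeral_2_eq_2)

text \<open>Row i of the left factor is a form in X and Y, and multiplying by the right factor
  substitutes the two linear forms of h for X and Y. Substituting into the linear forms of g gives
  those of \<open>g * h\<close>; rows as images keep the order of the factors.\<close>

lemma sym_power_mat_mult:
  assumes g: "g \<in> carrier_mat 2 2" and h: "h \<in> carrier_mat 2 2"
  shows "sym_power_mat N (g * h) = sym_power_mat N g * sym_power_mat N h"
proof (rule eq_matI)
  fix i k assume "i < dim_row (sym_power_mat N g * sym_power_mat N h)"
    "k < dim_col (sym_power_mat N g * sym_power_mat N h)"
  then have i: "i \<le> N" and k: "k \<le> N" by auto
  define L1 L2 where "L1 = [:g $$ (0,1), g $$ (0,0):]" and "L2 = [:g $$ (1,1), g $$ (1,0):]"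
  define H1 H2 where "H1 = [:h $$ (0,1), h $$ (0,0):]" and "H2 = [:h $$ (1,1), h $$ (1,0):]"
  have "(sym_power_mat N g * sym_power_mat N h) $$ (i, k)
    = (\<Sum>j\<le>N. poly.coeff (L1 ^ i * L2 ^ (N - i)) j * poly.coeff (H1 ^ j * H2 ^ (N - j)) k)"
    using i k unfolding sym_power_mat_def L1_def L2_def H1_def H2_def
    by (auto simp: scalar_prod_def lessThan_Suc_atMost atLeast0LessThan intro!: sum.cong)
  also have "\<dots> = poly.coeff (homog_eval N (L1 ^ i * L2 ^ (N - i)) H1 H2) k"
    unfolding homog_eval_def by (simp add: coeff_sum)
  also have "homog_eval N (L1 ^ i * L2 ^ (N - i)) H1 H2
    = (smult (g $$ (0,0)) H1 + smult (g $$ (0,1)) H2) ^ i *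
      (smult (g $$ (1,0)) H1 + smult (g $$ (1,1)) H2) ^ (N - i)"
    using homog_eval_linear_powers[of i "N - i"] i unfolding L1_def L2_def by simp
  also have "smult (g $$ (0,0)) H1 + smult (g $$ (0,1)) H2 = [:(g * h) $$ (0,1), (g * h) $$ (0,0):]"
    using mult_mat_2_index[OF g h] unfolding H1_def H2_def by simp
  also have "smult (g $$ (1,0)) H1 + smult (g $$ (1,1)) H2 = [:(g * h) $$ (1,1), (g * h) $$ (1,0):]"
    using mult_mat_2_index[OF g h] unfolding H1_def H2_def by simp
  finally show "sym_power_mat N (g * h) $$ (i, k) = (sym_power_mat N g * sym_power_mat N h) $$ (i, k)"
    using i k unfolding sym_power_mat_def by simp
qed auto

text \<open>Forms of degree N scale by c^N. Applied to g times its adjugate, this produces the power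
  of the determinant by which \<open>sym_power_inv\<close> divides.\<close>

lemma sym_power_mat_scalar:
  "sym_power_mat N (c \<cdot>\<^sub>m 1\<^sub>m 2) = c ^ N \<cdot>\<^sub>m 1\<^sub>m (Suc N)"
proof (rule eq_matI)
  fix i j assume "i < dim_row (c ^ N \<cdot>\<^sub>m 1\<^sub>m (Suc N))" "j < dim_col (c ^ N \<cdot>\<^sub>m 1\<^sub>m (Suc N))"
  then have ij: "i \<le> N" "j \<le> N" by auto
  have "[:0, c:] ^ i * [:c:] ^ (N - i) = monom (c ^ N) i"
  proof -
    have "[:0, c:] ^ i * [:c:] ^ (N - i) = monom (c ^ i * c ^ (N - i)) i"
    proof -
      have "[:0, c:] ^ i = monom (c ^ i) i"
        using monom_power[of c 1 i] by (simp add: monom_Suc monom_0)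
      moreover have "[:c:] ^ (N - i) = monom (c ^ (N - i)) 0"
        by (simp add: monom_0 poly_const_pow)
      ultimately show ?thesis by (simp only: mult_monom) simp
    qed
    then show ?thesis using ij by (simp flip: power_add)
  qed
  then show "sym_power_mat N (c \<cdot>\<^sub>m 1\<^sub>m 2) $$ (i, j) = (c ^ N \<cdot>\<^sub>m 1\<^sub>m (Suc N)) $$ (i, j)"
    using ij unfolding sym_power_mat_def by simp
qed auto

section \<open>Adjugates and inverses of symmetric powers\<close>

definition adj2 :: "'k::field mat \<Rightarrow> 'k mat" where
  "adj2 g = mat 2 2 (\<lambda>(i, j). if i = j then g $$ (1 - i, 1 - j) else - g $$ (i, j))"

lemma adj2_carrier [simp]: "adj2 g \<in> carrier_mat 2 2"
  unfolding adj2_def by simp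

lemma adj2_index:
  "adj2 g $$ (0,0) = g $$ (1,1)" "adj2 g $$ (0,1) = - g $$ (0,1)"
  "adj2 g $$ (1,0) = - g $$ (1,0)" "adj2 g $$ (1,1) = g $$ (0,0)"
  unfolding adj2_def by simp_all

lemma eq_mat_2I:
  assumes "A \<in> carrier_mat 2 2" "B \<in> carrier_mat 2 2"
    "A $$ (0,0) = B $$ (0,0)" "A $$ (0,1) = B $$ (0,1)"
    "A $$ (1,0) = B $$ (1,0)" "A $$ (1,1) = B $$ (1,1)"
  shows "A = B"
  using assms by (intro eq_matI) (auto simp: less_2_cases_iff)

lemma adj2_mult:
  assumes "g \<in> carrier_mat 2 2" "h \<in> carrier_mat 2 2"
  shows "adj2 (g * h) = adj2 h * adj2 g"
  using assms
  by (intro eq_mat_2I)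
    (simp_all add: adj2_index mult_mat_2_index mult_carrier_mat[of _ 2 2] algebra_simps
      del: One_nat_def index_mult_mat)

lemma det_mat_2:
  assumes "g \<in> carrier_mat 2 2"
  shows "det g = g $$ (0,0) * g $$ (1,1) - g $$ (0,1) * g $$ (1,0)"
proof -
  have "det g = g $$ (0,0) * cofactor g 0 0 + g $$ (0,1) * cofactor g 0 1"
    using laplace_expansion_row[OF assms, of 0] by (simp add: numeral_2_eq_2)
  moreover have "cofactor g 0 0 = g $$ (1,1)" "cofactor g 0 1 = - g $$ (1,0)"
    using assms unfolding cofactor_def
    by (auto simp: mat_delete_def det_single)
  ultimately show ?thesis by simp
qed

lemma mult_adj2:
  assumes "g \<in> carrier_mat 2 2"
  shows "g * adj2 g = det g \<cdot>\<^sub>m 1\<^sub>m 2"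
  using assms
  by (intro eq_mat_2I)
    (simp_all add: adj2_index mult_mat_2_index mult_carrier_mat[of _ 2 2] det_mat_2 algebra_simps
      del: One_nat_def index_mult_mat(1))

text \<open>
  The matrix of \<open>g\<^sup>-\<^sup>1\<close>, written through the adjugate so that its entries are visibly regular
  functions of \<open>g\<close>.
\<close>

definition sym_power_inv :: "nat \<Rightarrow> 'k::field mat \<Rightarrow> 'k mat" where
  "sym_power_inv N g = (1 / det g ^ N) \<cdot>\<^sub>m sym_power_mat N (adj2 g)"

lemma sym_power_inv_carrier [simp]: "sym_power_inv N g \<in> carrier_mat (Suc N) (Suc N)"
  unfolding sym_power_inv_def by simp

lemma sym_power_inv_dim [simp]:
  "dim_row (sym_power_inv N g) = Suc N" "dim_col (sym_power_inv N g) = Suc N"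
  unfolding sym_power_inv_def by simp_all

lemma sym_power_mat_inv:
  assumes "g \<in> carrier_mat 2 2" "det g \<noteq> 0"
  shows "sym_power_mat N g * sym_power_inv N g = 1\<^sub>m (Suc N)"
proof -
  have "sym_power_mat N g * sym_power_inv N g
    = (1 / det g ^ N) \<cdot>\<^sub>m sym_power_mat N (g * adj2 g)"
    unfolding sym_power_inv_def using assms(1)
    by (simp add: sym_power_mat_mult mult_smult_distrib[OF sym_power_mat_carrier sym_power_mat_carrier])
  also have "\<dots> = 1\<^sub>m (Suc N)"
    using assms by (intro eq_matI) (auto simp: mult_adj2 sym_power_mat_scalar)
  finally show ?thesis .
qed

lemma sym_power_inv_mult:
  assumes "g \<in> carrier_mat 2 2" "h \<in> carrier_mat 2 2"
  shows "sym_power_inv N (g * h) = sym_power_inv N h * sym_power_inv N g"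
proof -
  have "sym_power_inv N h * sym_power_inv N g
    = (1 / det h ^ N) \<cdot>\<^sub>m ((1 / det g ^ N) \<cdot>\<^sub>m (sym_power_mat N (adj2 h) * sym_power_mat N (adj2 g)))"
    unfolding sym_power_inv_def
    by (simp add: mult_smult_distrib[OF smult_carrier_mat[OF sym_power_mat_carrier] sym_power_mat_carrier]
        mult_smult_assoc_mat[OF sym_power_mat_carrier sym_power_mat_carrier])
      (intro eq_matI, auto)
  also have "\<dots> = sym_power_inv N (g * h)"
    unfolding sym_power_inv_def using assms
    by (intro eq_matI) (auto simp: adj2_mult sym_power_mat_mult det_mult power_mult_distrib)
  finally show ?thesis by simp
qed

section \<open>Projections onto spans of translates\<close>

definition unip :: "'k::field \<Rightarrow> 'k mat" where
  "unip t = mat 2 2 (\<lambda>(i, j). if i = j then 1 else if i = 0 then t else 0)"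

lemma unip_carrier [simp]: "unip t \<in> carrier_mat 2 2"
  unfolding unip_def by simp

lemma unip_index:
  "unip t $$ (0,0) = 1" "unip t $$ (0,1) = t" "unip t $$ (1,0) = 0" "unip t $$ (1,1) = 1"
  unfolding unip_def by simp_all

lemma det_unip: "det (unip t) = 1"
  by (simp add: det_mat_2 unip_index del: One_nat_def)

definition lagrange_poly :: "'k::field set \<Rightarrow> 'k \<Rightarrow> 'k poly" where
  "lagrange_poly E e = (\<Prod>y\<in>E - {e}. smult (1 / (e - y)) [:- y, 1:])"

lemma poly_lagrange_poly:
  assumes "finite E" "y \<in> E"
  shows "poly (lagrange_poly E e) y = of_bool (y = e)"
proof (cases "y = e")
  case True
  then show ?thesis unfolding lagrange_poly_def poly_prod by (auto intro!: prod.neutral simp flip: diff_divide_distrib split: if_splits)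
next
  case False
  then have "\<exists>z\<in>E - {e}. poly (smult (1 / (e - z)) [:- z, 1:]) y = 0"
    using assms by (intro bexI[of _ y]) auto
  then show ?thesis unfolding lagrange_poly_def poly_prod
    using False assms by (auto intro!: prod_zero)
qed

lemma degree_lagrange_poly:
  assumes "finite E" "e \<in> E"
  shows "degree (lagrange_poly E e) < card E"
proof -
  have "degree (lagrange_poly E e) \<le> (\<Sum>y\<in>E - {e}. 1)"
    unfolding lagrange_poly_def using assms
    by (intro order_trans[OF degree_prod_sum_le] sum_mono) auto
  also have "\<dots> < card E" using assms card_gt_0_iff[of E] by auto
  finally show ?thesis .
qed

lemma poly_eq_sum_coeff:
  fixes P :: "'k::comm_semiring_1 poly"
  assumes "degree P \<le> N"
  shows "poly P x = (\<Sum>j\<le>N. poly.coeff P j * x ^ j)"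
  unfolding poly_altdef using assms by (intro sum.mono_neutral_left) (auto simp: coeff_eq_0)

text \<open>
  The vectors \<open>w\<^sub>e = (e\<^sup>i)\<^sub>i\<close>, \<open>e \<in> E\<close>, form a basis that \<open>unip t\<close> permutes by
  \<open>w\<^sub>e \<mapsto> w\<^sub>e\<^sub>+\<^sub>t\<close>; the dual basis is given by the Lagrange polynomials. This is the projection onto
  the span of the \<open>w\<^sub>e\<close> with \<open>e \<in> S\<close>.
\<close>

definition lagrange_proj :: "nat \<Rightarrow> 'k::field set \<Rightarrow> 'k set \<Rightarrow> 'k mat" where
  "lagrange_proj N E S =
     mat (Suc N) (Suc N) (\<lambda>(i, j). \<Sum>e\<in>S. e ^ i * poly.coeff (lagrange_poly E e) j)"

lemma lagrange_proj_carrier [simp]: "lagrange_proj N E S \<in> carrier_mat (Suc N) (Suc N)"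
  unfolding lagrange_proj_def by simp

lemma lagrange_proj_dim [simp]:
  "dim_row (lagrange_proj N E S) = Suc N" "dim_col (lagrange_proj N E S) = Suc N"
  unfolding lagrange_proj_def by simp_all

lemma lagrange_proj_empty: "lagrange_proj N E {} = 0\<^sub>m (Suc N) (Suc N)"
  unfolding lagrange_proj_def by (intro eq_matI) auto

text \<open>Interpolating the values of X^i at the points of E returns X^i, since i is less than the
  number of nodes; row i records this identity.\<close>

lemma lagrange_proj_full:
  assumes "finite E" "card E = Suc N"
  shows "lagrange_proj N E E = 1\<^sub>m (Suc N)"
proof (rule eq_matI)
  fix i j assume "i < dim_row (1\<^sub>m (Suc N) :: 'a mat)" "j < dim_col (1\<^sub>m (Suc N) :: 'a mat)"
  then have ij: "i \<le> N" "j \<le> N" by auto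
  have "(\<Sum>e\<in>E. smult (e ^ i) (lagrange_poly E e)) = monom 1 i"
  proof (rule poly_eqI_degree[of E])
    fix y assume y: "y \<in> E"
    have "poly (\<Sum>e\<in>E. smult (e ^ i) (lagrange_poly E e)) y = (\<Sum>e\<in>E. e ^ i * of_bool (y = e))"
      using assms y by (simp add: poly_sum poly_lagrange_poly)
    also have "\<dots> = poly (monom 1 i) y"
      using assms y by (simp add: poly_monom)
    finally show "poly (\<Sum>e\<in>E. smult (e ^ i) (lagrange_poly E e)) y = poly (monom 1 i) y" .
  next
    show "degree (\<Sum>e\<in>E. smult (e ^ i) (lagrange_poly E e)) < card E"
      using assms degree_lagrange_poly[OF assms(1)]
      by (intro degree_sum_less) (auto intro: le_less_trans[OF degree_smult_le])
  qed (use ij assms in \<open>simp add: degree_monom_eq\<close>)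
  from arg_cong[OF this, of "\<lambda>P. poly.coeff P j"]
  show "lagrange_proj N E E $$ (i, j) = 1\<^sub>m (Suc N) $$ (i, j)"
    using ij unfolding lagrange_proj_def by (simp add: coeff_sum)
qed auto

text \<open>The substitution replaces X by X + tY and fixes Y, hence (X + t)^i after
  dehomogenising.\<close>

lemma sym_power_mat_unip_index:
  assumes "i \<le> N" "j \<le> N"
  shows "sym_power_mat N (unip t) $$ (i, j) = poly.coeff ([:t, 1:] ^ i) j"
  using assms unfolding sym_power_mat_def by (simp add: unip_index flip: one_pCons del: One_nat_def)

text \<open>\<open>unip t\<close> carries the basis vector of e to that of e + t, and the dual basis
  moves along: the Lagrange polynomial of e + t, composed with X + t, is that of e. Both sides are
  then the same sum of rank-one matrices over S.\<close>

lemma unip_lagrange_proj: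
  assumes E: "finite E" "card E = Suc N" "S \<subseteq> E"
    and t: "t \<in> E" and add: "\<And>r s. r \<in> E \<Longrightarrow> s \<in> E \<Longrightarrow> r + s \<in> E"
  shows "sym_power_mat N (unip t) * lagrange_proj N E S
    = lagrange_proj N E ((\<lambda>e. e + t) ` S) * sym_power_mat N (unip t)" (is "?A = ?B")
proof (rule eq_matI)
  fix i j assume "i < dim_row ?B" "j < dim_col ?B"
  then have ij: "i \<le> N" "j \<le> N" by auto
  have deg: "degree ([:t, 1:] ^ k) \<le> k" for k
    using degree_power_le[of "[:t, 1:]" k] by simp
  \<comment> \<open>Both polynomials have degree below \<open>card E\<close>, so agreement on E
    suffices; at y both equal the indicator of y = e.\<close>
  have shift: "(\<Sum>k\<le>N. smult (poly.coeff (lagrange_poly E (e + t)) k) ([:t, 1:] ^ k))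
      = lagrange_poly E e" (is "?P = _") if e: "e \<in> E" for e
  proof (rule poly_eqI_degree[of E])
    fix y assume y: "y \<in> E"
    have "poly ?P y = (\<Sum>k\<le>N. poly.coeff (lagrange_poly E (e + t)) k * (y + t) ^ k)"
      by (simp add: poly_sum add.commute)
    also have "\<dots> = poly (lagrange_poly E (e + t)) (y + t)"
      using degree_lagrange_poly[OF E(1) add[OF e t]] E(2) by (intro poly_eq_sum_coeff[symmetric]) simp
    also have "\<dots> = poly (lagrange_poly E e) y"
      using add t y E(1) by (simp add: poly_lagrange_poly)
    finally show "poly ?P y = poly (lagrange_poly E e) y" .
  next
    show "degree ?P < card E"
      unfolding E(2)
      by (intro degree_sum_less) (auto intro: le_less_trans[OF degree_smult_le] le_less_trans[OF deg])
    show "degree (lagrange_poly E e) < card E" using degree_lagrange_poly E(1) e by blast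
  qed
  have "?A $$ (i, j) = (\<Sum>k\<le>N. poly.coeff ([:t, 1:] ^ i) k *
      (\<Sum>e\<in>S. e ^ k * poly.coeff (lagrange_poly E e) j))"
    using ij sym_power_mat_unip_index[of i N _ t] unfolding lagrange_proj_def
    by (auto simp: scalar_prod_def lessThan_Suc_atMost atLeast0LessThan intro!: sum.cong)
  also have "\<dots> = (\<Sum>e\<in>S. (\<Sum>k\<le>N. poly.coeff ([:t, 1:] ^ i) k * e ^ k) *
      poly.coeff (lagrange_poly E e) j)"
    unfolding sum_distrib_left sum_distrib_right by (subst sum.swap) (simp add: mult.assoc)
  also have "\<dots> = (\<Sum>e\<in>S. (e + t) ^ i * poly.coeff (lagrange_poly E e) j)"
    using order_trans[OF deg ij(1)] by (simp add: poly_eq_sum_coeff[symmetric] add.commute)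
  also have "\<dots> = (\<Sum>e\<in>S. (e + t) ^ i * (\<Sum>k\<le>N. poly.coeff (lagrange_poly E (e + t)) k *
      poly.coeff ([:t, 1:] ^ k) j))"
  proof (intro sum.cong refl)
    fix e assume "e \<in> S"
    then show "(e + t) ^ i * poly.coeff (lagrange_poly E e) j =
      (e + t) ^ i * (\<Sum>k\<le>N. poly.coeff (lagrange_poly E (e + t)) k * poly.coeff ([:t, 1:] ^ k) j)"
      using arg_cong[OF shift[of e], of "\<lambda>P. poly.coeff P j"] E(3) by (auto simp: coeff_sum)
  qed
  also have "\<dots> = (\<Sum>k\<le>N. (\<Sum>e\<in>S. (e + t) ^ i * poly.coeff (lagrange_poly E (e + t)) k) *
      poly.coeff ([:t, 1:] ^ k) j)"
    unfolding sum_distrib_left sum_distrib_right by (subst sum.swap) (simp add: mult.assoc)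
  also have "\<dots> = (\<Sum>k\<le>N. (\<Sum>e\<in>(\<lambda>e. e + t) ` S. e ^ i * poly.coeff (lagrange_poly E e) k) *
      poly.coeff ([:t, 1:] ^ k) j)"
    by (subst sum.reindex) (auto simp: inj_on_def)
  also have "\<dots> = ?B $$ (i, j)"
    using ij sym_power_mat_unip_index[of _ N j t] unfolding lagrange_proj_def
    by (auto simp: scalar_prod_def lessThan_Suc_atMost atLeast0LessThan intro!: sum.cong)
  finally show "?A $$ (i, j) = ?B $$ (i, j)" .
qed auto

section \<open>The conjugation representation\<close>

definition vec_of_mat :: "nat \<Rightarrow> 'k mat \<Rightarrow> 'k vec" where
  "vec_of_mat q A = vec (q * q) (\<lambda>k. A $$ (k div q, k mod q))"

definition mat_of_vec :: "nat \<Rightarrow> 'k vec \<Rightarrow> 'k mat" where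
  "mat_of_vec q v = mat q q (\<lambda>(i, j). v $ (i * q + j))"

text \<open>The Kronecker product of A with the transpose of B, which is the map X -> A X B in the
  row-major coordinates of \<open>vec_of_mat\<close>.\<close>

definition two_sided_mult_mat :: "nat \<Rightarrow> 'k::semiring_0 mat \<Rightarrow> 'k mat \<Rightarrow> 'k mat" where
  "two_sided_mult_mat q A B =
     mat (q * q) (q * q) (\<lambda>(k, l). A $$ (k div q, l div q) * B $$ (l mod q, k mod q))"

lemma div_mod_less_square:
  assumes "k < q * q"
  shows "k div q < q" "k mod q < (q :: nat)"
  using assms by (auto simp: less_mult_imp_div_less intro!: mod_less_divisor gr_zeroI)

lemma pair_index_less_square:
  assumes "i < q" "j < (q :: nat)"
  shows "i * q + j < q * q"
proof -
  have "i * q + j < Suc i * q" using assms by simp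
  also have "\<dots> \<le> q * q" using assms by (intro mult_right_mono) auto
  finally show ?thesis .
qed

lemma sum_div_mod_square:
  fixes h :: "nat \<Rightarrow> nat \<Rightarrow> 'b::comm_monoid_add"
  shows "(\<Sum>l<q * q. h (l div q) (l mod q)) = (\<Sum>i<q. \<Sum>j<q. h i j)"
  unfolding sum.cartesian_product
  by (rule sum.reindex_bij_witness[where i = "\<lambda>(i, j). i * q + j" and j = "\<lambda>l. (l div q, l mod q)"])
    (auto simp: div_mod_less_square pair_index_less_square)

lemma mat_of_vec_carrier [simp]: "mat_of_vec q v \<in> carrier_mat q q"
  unfolding mat_of_vec_def by simp

lemma vec_of_mat_carrier [simp]: "vec_of_mat q A \<in> carrier_vec (q * q)"
  unfolding vec_of_mat_def by simp

lemma mat_of_vec_of_mat: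
  assumes "A \<in> carrier_mat q q"
  shows "mat_of_vec q (vec_of_mat q A) = A"
  using assms unfolding mat_of_vec_def vec_of_mat_def
  by (intro eq_matI) (auto simp: pair_index_less_square)

lemma vec_of_mat_of_vec:
  assumes "v \<in> carrier_vec (q * q)"
  shows "vec_of_mat q (mat_of_vec q v) = v"
  using assms unfolding mat_of_vec_def vec_of_mat_def
  by (intro eq_vecI) (auto simp: div_mod_less_square)

lemma two_sided_mult_mat_vec:
  fixes A B X :: "'k::comm_semiring_0 mat"
  assumes "A \<in> carrier_mat q q" "B \<in> carrier_mat q q" "X \<in> carrier_mat q q"
  shows "two_sided_mult_mat q A B *\<^sub>v vec_of_mat q X = vec_of_mat q (A * X * B)"
proof (rule eq_vecI)
  fix k assume "k < dim_vec (vec_of_mat q (A * X * B))"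
  then have k: "k < q * q" by (simp add: vec_of_mat_def)
  note [simp] = div_mod_less_square[OF k]
  have "(two_sided_mult_mat q A B *\<^sub>v vec_of_mat q X) $ k
    = (\<Sum>l<q * q. A $$ (k div q, l div q) * B $$ (l mod q, k mod q) * X $$ (l div q, l mod q))"
    using k unfolding two_sided_mult_mat_def vec_of_mat_def
    by (auto simp: scalar_prod_def atLeast0LessThan intro!: sum.cong)
  also have "\<dots> = (\<Sum>i<q. \<Sum>j<q. A $$ (k div q, i) * B $$ (j, k mod q) * X $$ (i, j))"
    by (rule sum_div_mod_square)
  also have "\<dots> = (\<Sum>j<q. (\<Sum>i<q. A $$ (k div q, i) * X $$ (i, j)) * B $$ (j, k mod q))"
    unfolding sum_distrib_right by (subst sum.swap) (simp add: ac_simps)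
  also have "\<dots> = (A * X * B) $$ (k div q, k mod q)"
    using assms by (auto simp: scalar_prod_def atLeast0LessThan simp del: assoc_mult_mat intro!: sum.cong)
  finally show "(two_sided_mult_mat q A B *\<^sub>v vec_of_mat q X) $ k = vec_of_mat q (A * X * B) $ k"
    using k by (simp add: vec_of_mat_def)
qed (simp add: two_sided_mult_mat_def vec_of_mat_def)

lemma two_sided_mult_mat_carrier [simp]:
  "two_sided_mult_mat q A B \<in> carrier_mat (q * q) (q * q)"
  unfolding two_sided_mult_mat_def by simp

text \<open>Right multiplications compose in reverse order. This matches
  \<open>sym_power_inv\<close>, which also reverses products, so that \<open>conj_rep\<close>
  becomes multiplicative.\<close>

lemma two_sided_mult_mat_mult:
  fixes A B C D :: "'k::comm_semiring_0 mat"
  assumes "A \<in> carrier_mat q q" "B \<in> carrier_mat q q" "C \<in> carrier_mat q q" "D \<in> carrier_mat q q"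
  shows "two_sided_mult_mat q A B * two_sided_mult_mat q C D = two_sided_mult_mat q (A * C) (D * B)"
proof (rule eq_matI)
  fix k m assume "k < dim_row (two_sided_mult_mat q (A * C) (D * B))"
    "m < dim_col (two_sided_mult_mat q (A * C) (D * B))"
  then have km: "k < q * q" "m < q * q" by (auto simp: two_sided_mult_mat_def)
  note [simp] = div_mod_less_square[OF km(1)] div_mod_less_square[OF km(2)]
  have "(two_sided_mult_mat q A B * two_sided_mult_mat q C D) $$ (k, m)
    = (\<Sum>l<q * q. A $$ (k div q, l div q) * B $$ (l mod q, k mod q) *
        (C $$ (l div q, m div q) * D $$ (m mod q, l mod q)))"
    using km unfolding two_sided_mult_mat_def
    by (auto simp: scalar_prod_def atLeast0LessThan intro!: sum.cong)
  also have "\<dots> = (\<Sum>i<q. \<Sum>j<q. A $$ (k div q, i) * B $$ (j, k mod q) *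
        (C $$ (i, m div q) * D $$ (m mod q, j)))"
    by (rule sum_div_mod_square)
  also have "\<dots> = (\<Sum>i<q. A $$ (k div q, i) * C $$ (i, m div q)) *
      (\<Sum>j<q. D $$ (m mod q, j) * B $$ (j, k mod q))"
    unfolding sum_product by (simp add: ac_simps)
  also have "\<dots> = (A * C) $$ (k div q, m div q) * (D * B) $$ (m mod q, k mod q)"
    using assms by (auto simp: scalar_prod_def atLeast0LessThan)
  finally show "(two_sided_mult_mat q A B * two_sided_mult_mat q C D) $$ (k, m)
    = two_sided_mult_mat q (A * C) (D * B) $$ (k, m)"
    using km by (simp add: two_sided_mult_mat_def)
qed (auto simp: two_sided_mult_mat_def)

lemma two_sided_mult_mat_one: "two_sided_mult_mat q (1\<^sub>m q) (1\<^sub>m q) = (1\<^sub>m (q * q) :: 'k::semiring_1 mat)"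
proof (rule eq_matI)
  fix k l assume "k < dim_row (1\<^sub>m (q * q) :: 'k mat)" "l < dim_col (1\<^sub>m (q * q) :: 'k mat)"
  then have kl: "k < q * q" "l < q * q" by auto
  have "k = l \<longleftrightarrow> k div q = l div q \<and> k mod q = l mod q"
    by (metis div_mult_mod_eq)
  then show "two_sided_mult_mat q (1\<^sub>m q) (1\<^sub>m q) $$ (k, l) = (1\<^sub>m (q * q) :: 'k mat) $$ (k, l)"
    using kl div_mod_less_square[OF kl(1)] div_mod_less_square[OF kl(2)]
    by (auto simp: two_sided_mult_mat_def)
qed (auto simp: two_sided_mult_mat_def)

section \<open>General linear groups and the module of endomorphisms\<close>

lemma carrier_GL: "carrier (GL n) = {g \<in> carrier_mat n n. det g \<noteq> (0 :: 'k::field)}"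
  using unit_imp_det_non_zero[where n = n and b = "()" and ?'a = 'k]
    det_non_zero_imp_unit[where n = n and b = "()" and ?'a = 'k]
  unfolding GL_def units_of_carrier
  by (auto simp: Units_def ring_mat_simps)

lemma mult_GL [simp]: "g \<otimes>\<^bsub>GL n\<^esub> h = g * h"
  unfolding GL_def units_of_mult ring_mat_simps ..

lemma one_GL [simp]: "\<one>\<^bsub>GL n\<^esub> = 1\<^sub>m n"
  unfolding GL_def units_of_one ring_mat_simps ..

lemma group_GL: "group (GL n :: 'k::field mat monoid)"
  unfolding GL_def
  by (intro monoid.units_group semiring.axioms(2)[OF semiring_mat])

definition conj_rep :: "nat \<Rightarrow> 'k::field mat \<Rightarrow> 'k mat" where
  "conj_rep N g = two_sided_mult_mat (Suc N) (sym_power_mat N g) (sym_power_inv N g)"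

lemma conj_rep_carrier [simp]: "conj_rep N g \<in> carrier_mat (Suc N * Suc N) (Suc N * Suc N)"
  unfolding conj_rep_def by (rule two_sided_mult_mat_carrier)

lemma conj_rep_mult:
  assumes "g \<in> carrier_mat 2 2" "h \<in> carrier_mat 2 2"
  shows "conj_rep N (g * h) = conj_rep N g * conj_rep N h"
  unfolding conj_rep_def using assms
  by (simp add: two_sided_mult_mat_mult[OF sym_power_mat_carrier sym_power_inv_carrier
        sym_power_mat_carrier sym_power_inv_carrier] sym_power_mat_mult sym_power_inv_mult)

lemma conj_rep_one: "conj_rep N (1\<^sub>m 2) = (1\<^sub>m (Suc N * Suc N) :: 'k::field mat)"
proof -
  have S: "sym_power_mat N (1\<^sub>m 2 :: 'k mat) = 1\<^sub>m (Suc N)"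
  proof -
    have "(1\<^sub>m 2 :: 'k mat) = 1 \<cdot>\<^sub>m 1\<^sub>m 2" "1 ^ N \<cdot>\<^sub>m 1\<^sub>m (Suc N) = (1\<^sub>m (Suc N) :: 'k mat)"
      by (intro eq_matI; simp)+
    then show ?thesis using sym_power_mat_scalar[of N "1 :: 'k"] by simp
  qed
  have "sym_power_inv N (1\<^sub>m 2 :: 'k mat) = 1\<^sub>m (Suc N)"
    using sym_power_mat_inv[of "1\<^sub>m 2 :: 'k mat" N] S left_mult_one_mat[OF sym_power_inv_carrier]
    by simp
  then show ?thesis unfolding conj_rep_def S by (simp only: two_sided_mult_mat_one)
qed

lemma conj_rep_vec_of_mat:
  assumes "X \<in> carrier_mat (Suc N) (Suc N)"
  shows "conj_rep N g *\<^sub>v vec_of_mat (Suc N) X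
    = vec_of_mat (Suc N) (sym_power_mat N g * X * sym_power_inv N g)"
  unfolding conj_rep_def using assms by (intro two_sided_mult_mat_vec) auto

lemma poly_funs_sym_power_mat:
  assumes "a \<in> poly_funs X I x" "b \<in> poly_funs X I x" "c \<in> poly_funs X I x" "d \<in> poly_funs X I x"
    and "\<And>v. h v $$ (0,0) = a v" "\<And>v. h v $$ (0,1) = b v"
      "\<And>v. h v $$ (1,0) = c v" "\<And>v. h v $$ (1,1) = d v"
    and "i \<le> N" "j \<le> N"
  shows "(\<lambda>v. sym_power_mat N (h v) $$ (i, j)) \<in> poly_funs X I x"
  using assms(9,10) unfolding sym_power_mat_def assms(5-8)
  by (simp add: less_Suc_eq_le)
    (intro poly_funs_coeff_mult poly_funs_coeff_power poly_funs_coeff_linear assms(1-4))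

text \<open>Each entry is a polynomial in the entries of g and of its adjugate, divided by a power
  of det g. Invertibility follows from multiplicativity applied to an inverse of g.\<close>

lemma G_module_conj_rep:
  fixes G :: "'k::field mat set"
  assumes G: "G \<subseteq> carrier (GL 2)"
  shows "G_module 2 G (Suc N * Suc N) (conj_rep N)"
  unfolding G_module_def
proof (intro conjI allI impI)
  let ?q = "Suc N"
  have car: "g \<in> carrier_mat 2 2" "det g \<noteq> 0" if "g \<in> G" for g
    using G that by (auto simp: carrier_GL)
  have "conj_rep N g \<in> carrier (GL (?q * ?q))" if g: "g \<in> carrier (GL 2)" for g :: "'k mat"
  proof -
    interpret group "GL 2 :: 'k mat monoid" by (rule group_GL)
    obtain h where h: "h \<in> carrier (GL 2)" "g * h = 1\<^sub>m 2"
      using r_inv_ex[OF g] by auto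
    have "conj_rep N g * conj_rep N h = 1\<^sub>m (?q * ?q)"
      using g h conj_rep_mult[of g h N] conj_rep_one[of N, where ?'k = 'k] by (simp add: carrier_GL)
    then have "det (conj_rep N g) * det (conj_rep N h) = 1"
      using det_mult[OF conj_rep_carrier[of N g] conj_rep_carrier[of N h]] det_one by metis
    then have "det (conj_rep N g) \<noteq> 0" by auto
    then show ?thesis using conj_rep_carrier[of N g] by (simp add: carrier_GL)
  qed
  then show "conj_rep N \<in> hom (GL 2\<lparr>carrier := G\<rparr>) (GL (?q * ?q))"
    using G car by (intro homI) (auto simp: conj_rep_mult)
next
  fix k l assume kl: "k < Suc N * Suc N" "l < Suc N * Suc N"
  let ?q = "Suc N" and ?X = "carrier_mat 2 2 :: 'k mat set" and ?I = "{..<2} \<times> {..<2} :: (nat \<times> nat) set"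
  define P where "P g = sym_power_mat N g $$ (k div ?q, l div ?q) *
    sym_power_mat N (adj2 g) $$ (l mod ?q, k mod ?q)" for g :: "'k mat"
  have coord: "(\<lambda>g. g $$ ij) \<in> poly_funs ?X ?I ($$)" if "ij \<in> ?I" for ij
    using that by (intro poly_funs_coord) auto
  have neg: "(\<lambda>g. - g $$ ij) \<in> poly_funs ?X ?I ($$)" if "ij \<in> ?I" for ij
    using poly_funs_mult[OF poly_funs_const[of "-1"] coord[OF that]] by simp
  have "P \<in> poly_funs ?X ?I ($$)"
    unfolding P_def using div_mod_less_square[OF kl(1)] div_mod_less_square[OF kl(2)]
    by (intro poly_funs_mult poly_funs_sym_power_mat[OF coord coord coord coord]
        poly_funs_sym_power_mat[OF coord neg neg coord])
      (auto simp: adj2_index[unfolded One_nat_def])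
  then obtain d where d: "P \<in> poly_funs_le ?X ?I ($$) d" unfolding poly_funs_def by blast
  have "(\<lambda>g. P g / det g ^ N) \<in> regular_funs_GL 2"
    unfolding regular_funs_GL_def using d by blast
  moreover have "conj_rep N g $$ (k, l) = P g / det g ^ N" for g
    using kl div_mod_less_square[OF kl(1)] div_mod_less_square[OF kl(2)]
    by (simp add: conj_rep_def two_sided_mult_mat_def sym_power_inv_def P_def)
  ultimately show "\<exists>f\<in>regular_funs_GL 2. \<forall>g\<in>G. conj_rep N g $$ (k, l) = f g"
    by (intro bexI[of _ "\<lambda>g. P g / det g ^ N"]) auto
qed

text \<open>The Leibniz formula shows that det is polynomial in the coordinates. Its invariance is
  checked for all of \<open>GL 2\<close>, which covers the inverses occurring in the definition of
  invariants.\<close>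

lemma det_conj_rep_invariant:
  fixes G :: "'k::field mat set"
  assumes G: "subgroup G (GL 2)"
  shows "(\<lambda>v. det (mat_of_vec (Suc N) v)) \<in> invariants 2 G (Suc N * Suc N) (conj_rep N)"
proof -
  let ?q = "Suc N"
  let ?f = "\<lambda>v :: 'k vec. det (mat_of_vec ?q v)"
  interpret group "GL 2 :: 'k mat monoid" by (rule group_GL)
  have "?f = (\<lambda>v. \<Sum>p\<in>{p. p permutes {0..<?q}}. signof p * (\<Prod>i=0..<?q. mat_of_vec ?q v $$ (i, p i)))"
    by (simp add: det_def'[OF mat_of_vec_carrier])
  also have "\<dots> \<in> poly_funs (carrier_vec (?q * ?q)) {..<?q * ?q} ($)"
  proof (intro poly_funs_sum poly_funs_mult poly_funs_const poly_funs_prod)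
    fix p i assume "p \<in> {p. p permutes {0..<?q}}" and i: "i \<in> {0..<?q}"
    then have p: "p i < ?q" using permutes_in_image[of p "{0..<?q}" i] by auto
    then have "i * ?q + p i \<in> {..<?q * ?q}" using i pair_index_less_square[of i ?q "p i"] by auto
    from poly_funs_coord[OF finite_lessThan this]
    show "(\<lambda>v. mat_of_vec ?q v $$ (i, p i)) \<in> poly_funs (carrier_vec (?q * ?q)) {..<?q * ?q} ($)"
      using i p unfolding mat_of_vec_def by simp
  qed
  finally obtain d where d: "?f \<in> poly_funs_le (carrier_vec (?q * ?q)) {..<?q * ?q} ($) d"
    unfolding poly_funs_def by blast
  have "?f (conj_rep N g *\<^sub>v v) = ?f v"
    if g: "g \<in> carrier (GL 2)" and v: "v \<in> carrier_vec (?q * ?q)" for g v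
  proof -
    let ?S = "sym_power_mat N g" and ?D = "sym_power_inv N g" and ?X = "mat_of_vec ?q v"
    have car: "?S * ?X \<in> carrier_mat ?q ?q" by (rule mult_carrier_mat[of _ ?q ?q]) auto
    have "conj_rep N g *\<^sub>v v = vec_of_mat ?q (?S * ?X * ?D)"
      using conj_rep_vec_of_mat[of ?X N g] vec_of_mat_of_vec[OF v] by simp
    then have "?f (conj_rep N g *\<^sub>v v) = det (?S * ?X * ?D)"
      using mat_of_vec_of_mat[OF mult_carrier_mat[OF car sym_power_inv_carrier]] by simp
    also have "\<dots> = det (?S * ?D) * det ?X"
      using det_mult[OF car sym_power_inv_carrier] det_mult[of ?S ?q ?X] det_mult[of ?S ?q ?D] by simp
    also have "?S * ?D = 1\<^sub>m ?q" using g by (simp add: carrier_GL sym_power_mat_inv)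
    finally show ?thesis by simp
  qed
  then have "?f \<in> invariants_le 2 G (?q * ?q) (conj_rep N) d"
    unfolding invariants_le_def using d subgroup.mem_carrier[OF G] by auto
  then show ?thesis unfolding invariants_def by blast
qed

lemma conj_rep_fixes_one:
  assumes "G \<subseteq> carrier (GL 2)"
  shows "vec_of_mat (Suc N) (1\<^sub>m (Suc N)) \<in> fixed_vecs G (Suc N * Suc N) (conj_rep N)"
proof -
  have "conj_rep N g *\<^sub>v vec_of_mat (Suc N) (1\<^sub>m (Suc N)) = vec_of_mat (Suc N) (1\<^sub>m (Suc N))"
    if "g \<in> G" for g
    using assms that
    by (auto simp: conj_rep_vec_of_mat carrier_GL sym_power_mat_inv right_mult_one_mat[OF sym_power_mat_carrier])
  then show ?thesis unfolding fixed_vecs_def using vec_of_mat_carrier[of "Suc N"] by auto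
qed

lemma vec_of_mat_zero: "vec_of_mat q (0\<^sub>m q q) = 0\<^sub>v (q * q)"
  unfolding vec_of_mat_def by (intro eq_vecI) (auto simp: div_mod_less_square)

text \<open>The determinant separates the identity from the origin: the matrices have positive size
  \<open>Suc N\<close>, so det vanishes at 0 and lies in the plus part.\<close>

lemma one_notin_nullcone:
  fixes G :: "'k::field mat set"
  assumes "subgroup G (GL 2)"
  shows "vec_of_mat (Suc N) (1\<^sub>m (Suc N)) \<notin> nullcone 2 G (Suc N * Suc N) (conj_rep N)"
proof
  let ?q = "Suc N"
  let ?f = "\<lambda>v :: 'k vec. det (mat_of_vec ?q v)"
  assume "vec_of_mat ?q (1\<^sub>m ?q) \<in> nullcone 2 G (?q * ?q) (conj_rep N)"
  then have null: "\<forall>f\<in>plus_part (?q * ?q) (invariants 2 G (?q * ?q) (conj_rep N)).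
      f (vec_of_mat ?q (1\<^sub>m ?q)) = 0"
    unfolding nullcone_def by (simp del: mult_Suc mult_Suc_right)
  have "?f (0\<^sub>v (?q * ?q)) = 0"
    unfolding vec_of_mat_zero[symmetric] mat_of_vec_of_mat[OF zero_carrier_mat] by simp
  then have "?f \<in> plus_part (?q * ?q) (invariants 2 G (?q * ?q) (conj_rep N))"
    using det_conj_rep_invariant[OF assms, of N] unfolding plus_part_def by blast
  from bspec[OF null this] show False
    unfolding mat_of_vec_of_mat[OF one_carrier_mat] by simp
qed

lemma low_degree_invariant_one_eq_0:
  fixes G :: "'k::field mat set" and E :: "'k set"
  assumes "CHAR('k) > 0" and G: "subgroup G (GL 2)"
    and h: "h \<in> carrier_mat 2 2" "det h \<noteq> 0"
    and E: "finite E" "card E = Suc N" "\<And>s t. s \<in> E \<Longrightarrow> t \<in> E \<Longrightarrow> s + t \<in> E"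
    and conj: "\<And>t. t \<in> E \<Longrightarrow> \<exists>u\<in>G. u * h = h * unip t"
    and f: "f \<in> invariants_le 2 G (Suc N * Suc N) (conj_rep N) d" "d < card E"
      "f (0\<^sub>v (Suc N * Suc N)) = 0"
  shows "f (vec_of_mat (Suc N) (1\<^sub>m (Suc N))) = 0"
proof -
  let ?q = "Suc N" and ?S = "sym_power_mat N" and ?D = "sym_power_inv N"
  let ?c = "carrier_mat (Suc N) (Suc N)"
  \<comment> \<open>Conjugating by the image of h turns the projections adapted to
    \<open>unip t\<close> into ones permuted by the corresponding elements of G. The extreme values
    0 and 1 are unchanged.\<close>
  define y where "y S = vec_of_mat ?q (?S h * lagrange_proj N E S * ?D h)" for S
  \<comment> \<open>The sign can be built into F, because translation preserves the cardinality of
    S.\<close>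
  define F where "F S = (-1) ^ card S * f (y S)" for S
  have mc [simp]: "A * B \<in> ?c" if "A \<in> ?c" "B \<in> ?c" for A B :: "'k mat"
    using that by (rule mult_carrier_mat)
  have inv_f: "f (conj_rep N u *\<^sub>v v) = f v" if u: "u \<in> G" and v: "v \<in> carrier_vec (?q * ?q)" for u v
  proof -
    interpret group "GL 2 :: 'k mat monoid" by (rule group_GL)
    have "inv\<^bsub>GL 2\<^esub> u \<in> G" "inv\<^bsub>GL 2\<^esub> (inv\<^bsub>GL 2\<^esub> u) = u"
      using u G subgroup.mem_carrier[OF G u] by (auto intro: subgroup.m_inv_closed)
    then show ?thesis using f(1) v unfolding invariants_le_def by force
  qed
  have "F ((\<lambda>e. e + t) ` S) = F S" if S: "S \<subseteq> E" and t: "t \<in> E" for S t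
  proof -
    obtain u where u: "u \<in> G" "u * h = h * unip t" using conj[OF t] by blast
    have uc: "u \<in> carrier_mat 2 2" using subgroup.mem_carrier[OF G u(1)] by (simp add: carrier_GL)
    let ?P = "lagrange_proj N E S" and ?P' = "lagrange_proj N E ((\<lambda>e. e + t) ` S)"
    have SS: "?S u * ?S h = ?S h * ?S (unip t)" and DD: "?D h * ?D u = ?D (unip t) * ?D h"
      using u(2) h(1) uc
      by (simp_all flip: sym_power_mat_mult sym_power_inv_mult)
    have "conj_rep N u *\<^sub>v y S = vec_of_mat ?q (?S u * (?S h * ?P * ?D h) * ?D u)"
      unfolding y_def by (rule conj_rep_vec_of_mat) simp
    also have "?S u * (?S h * ?P * ?D h) * ?D u = (?S u * ?S h) * ?P * (?D h * ?D u)"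
      by (simp add: assoc_mult_mat[of _ ?q ?q _ ?q _ ?q])
    also have "\<dots> = ?S h * (?S (unip t) * ?P) * ?D (unip t) * ?D h"
      unfolding SS DD by (simp add: assoc_mult_mat[of _ ?q ?q _ ?q _ ?q])
    also have "?S (unip t) * ?P = ?P' * ?S (unip t)"
      by (rule unip_lagrange_proj[OF E(1,2) S t E(3)])
    also have "?S h * (?P' * ?S (unip t)) * ?D (unip t) * ?D h
      = ?S h * (?P' * (?S (unip t) * ?D (unip t))) * ?D h"
      by (simp add: assoc_mult_mat[of _ ?q ?q _ ?q _ ?q])
    also have "\<dots> = ?S h * ?P' * ?D h"
      by (simp add: sym_power_mat_inv det_unip right_mult_one_mat[OF lagrange_proj_carrier])
    finally have "f (y ((\<lambda>e. e + t) ` S)) = f (y S)"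
      using inv_f[OF u(1), of "y S"] unfolding y_def
      by (simp del: mult_Suc mult_Suc_right)
    then show ?thesis unfolding F_def by (simp add: card_image)
  qed
  then have "sum F (Pow E) = F {} + F E"
    using assms(1) E by (intro sum_shift_invariant_Pow_CHAR) auto
  moreover have "sum F (Pow E) = 0"
  proof -
    \<comment> \<open>The k-th coordinate of the rank-one projection belonging to e, after
      conjugation. These add up over S, so the coordinates of \<open>y S\<close> are linear forms as
      the alternating sum requires.\<close>
    define a where "a k e = (\<Sum>j<?q. (\<Sum>i<?q. ?S h $$ (k div ?q, i) *
      (e ^ i * poly.coeff (lagrange_poly E e) j)) * ?D h $$ (j, k mod ?q))" for k e
    have coord: "y S $ k = (\<Sum>e\<in>S. a k e)" if "k < ?q * ?q" for S k
    proof -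
      note dm = div_mod_less_square[OF that]
      have "y S $ k = (\<Sum>j<?q. (\<Sum>i<?q. ?S h $$ (k div ?q, i) *
        (\<Sum>e\<in>S. e ^ i * poly.coeff (lagrange_poly E e) j)) * ?D h $$ (j, k mod ?q))"
        using that dm unfolding y_def vec_of_mat_def lagrange_proj_def
        by (auto simp: scalar_prod_def atLeast0LessThan simp del: assoc_mult_mat intro!: sum.cong)
      also have "\<dots> = (\<Sum>j<?q. (\<Sum>e\<in>S. \<Sum>i<?q. ?S h $$ (k div ?q, i) *
        (e ^ i * poly.coeff (lagrange_poly E e) j)) * ?D h $$ (j, k mod ?q))"
        unfolding sum_distrib_left by (subst sum.swap) (rule refl)
      also have "\<dots> = (\<Sum>e\<in>S. a k e)"
        unfolding a_def sum_distrib_right[of _ S] by (rule sum.swap)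
      finally show ?thesis .
    qed
    have "f \<in> poly_funs_le (carrier_vec (?q * ?q)) {..<?q * ?q} ($) d"
      using f(1) unfolding invariants_le_def by (simp del: mult_Suc mult_Suc_right)
    from alternating_sum_Pow_poly_fun[OF this finite_lessThan E(1) f(2), of y a]
    show ?thesis
      using coord unfolding F_def y_def by (metis vec_of_mat_carrier lessThan_iff)
  qed
  moreover have "y {} = 0\<^sub>v (?q * ?q)"
    unfolding y_def lagrange_proj_empty
    by (simp add: vec_of_mat_zero right_mult_zero_mat[OF sym_power_mat_carrier]
        left_mult_zero_mat[OF sym_power_inv_carrier] del: mult_Suc mult_Suc_right)
  moreover have "y E = vec_of_mat ?q (1\<^sub>m ?q)"
    unfolding y_def lagrange_proj_full[OF E(1,2)]
    by (simp add: right_mult_one_mat[OF sym_power_mat_carrier] sym_power_mat_inv h)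
  \<comment> \<open>The empty set contributes f(0) = 0, so the remaining term for E, which is f at
    the identity up to sign, vanishes.\<close>
  ultimately show ?thesis using f(3) by (simp add: F_def)
qed

section \<open>Unipotent subgroups of two-by-two matrices\<close>

text \<open>The nilpotent A = u - 1 has determinant 0, so Cayley-Hamilton reads A^2 = t A with t the
  trace. Powers of A are then powers of t times A, and nilpotency forces t = 0.\<close>

lemma unipotent_mat_2:
  fixes u :: "'k::field mat"
  assumes "unipotent_mat 2 u"
  shows "u $$ (0,0) + u $$ (1,1) = 2"
    and "(u $$ (0,0) - 1) * (u $$ (1,1) - 1) = u $$ (0,1) * u $$ (1,0)"
proof -
  define A where "A = u - 1\<^sub>m 2"
  obtain e where u: "u \<in> carrier_mat 2 2" and e: "A ^\<^sub>m e = 0\<^sub>m 2 2"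
    using assms unfolding unipotent_mat_def A_def by blast
  have A: "A \<in> carrier_mat 2 2" unfolding A_def by (rule minus_carrier_mat) simp
  have ind: "A $$ (0,0) = u $$ (0,0) - 1" "A $$ (0,1) = u $$ (0,1)" "A $$ (1,0) = u $$ (1,0)"
    "A $$ (1,1) = u $$ (1,1) - 1"
    unfolding A_def using u by simp_all
  have "det (A ^\<^sub>m n) = det A ^ n" for n
    using A by (induction n) (simp_all add: det_mult[OF pow_carrier_mat])
  from this[of e] have det0: "det A = 0" unfolding e by simp
  then show "(u $$ (0,0) - 1) * (u $$ (1,1) - 1) = u $$ (0,1) * u $$ (1,0)"
    using det_mat_2[OF A] unfolding ind by simp
  define t where "t = A $$ (0,0) + A $$ (1,1)"
  have sq: "A * A = t \<cdot>\<^sub>m A"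
    using A det_mat_2[OF A] det0 unfolding t_def
    by (intro eq_mat_2I) (simp_all add: mult_mat_2_index mult_carrier_mat[of _ 2 2] algebra_simps
        del: One_nat_def index_mult_mat(1))
  have pow: "A ^\<^sub>m Suc n = t ^ n \<cdot>\<^sub>m A" for n
  proof (induction n)
    case 0
    have "1 \<cdot>\<^sub>m A = A" by (intro eq_matI) auto
    then show ?case using A by simp
  next
    case (Suc n)
    have "A ^\<^sub>m Suc (Suc n) = (t ^ n \<cdot>\<^sub>m A) * A" using Suc by simp
    also have "\<dots> = t ^ n \<cdot>\<^sub>m (t \<cdot>\<^sub>m A)" using A by (simp add: mult_smult_assoc_mat[OF A A] sq)
    also have "\<dots> = t ^ Suc n \<cdot>\<^sub>m A" by (intro eq_matI) auto
    finally show ?case .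
  qed
  have "t = 0"
  proof (rule ccontr)
    assume "t \<noteq> 0"
    have "t ^ e \<cdot>\<^sub>m A = 0\<^sub>m 2 2"
      using e pow[of e] left_mult_zero_mat[OF A] by simp
    then have "(t ^ e \<cdot>\<^sub>m A) $$ (i, i) = 0" if "i < 2" for i using that by simp
    from this[of 0] this[of 1] have "A $$ (0,0) = 0" "A $$ (1,1) = 0"
      using \<open>t \<noteq> 0\<close> A by simp_all
    then show False using \<open>t \<noteq> 0\<close> unfolding t_def by simp
  qed
  then have "(u $$ (0,0) - 1) + (u $$ (1,1) - 1) = 0" unfolding t_def ind .
  then show "u $$ (0,0) + u $$ (1,1) = 2" by (simp add: algebra_simps)
qed

text \<open>Fix a nontrivial w = 1 + A in U. For any u = 1 + B in U, unipotency of u and of w u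
  gives tr(AB) = 0, and for nilpotent matrices of size two this makes B a multiple of A. Thus U is
  parametrised by a set of scalars.\<close>

lemma unipotent_subgroup_conj_unip:
  fixes U :: "'k::field mat set"
  assumes U: "unipotent_subgroup_GL 2 U" and inf: "infinite U"
  obtains h T where "h \<in> carrier_mat 2 2" "det h \<noteq> 0" "infinite T" "0 \<in> T"
    "\<And>s t. s \<in> T \<Longrightarrow> t \<in> T \<Longrightarrow> s + t \<in> T"
    "\<And>t. t \<in> T \<Longrightarrow> \<exists>u\<in>U. u * h = h * unip t"
proof -
  have sub: "subgroup U (GL 2)" and uni: "\<And>u. u \<in> U \<Longrightarrow> unipotent_mat 2 u"
    using U unfolding unipotent_subgroup_GL_def by auto
  have car: "u \<in> carrier_mat 2 2" if "u \<in> U" for u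
    using uni[OF that] unfolding unipotent_mat_def by blast
  have oneU: "1\<^sub>m 2 \<in> U" using subgroup.one_closed[OF sub] by simp
  have multU: "u * v \<in> U" if "u \<in> U" "v \<in> U" for u v
    using subgroup.m_closed[OF sub that] by simp
  obtain w where w: "w \<in> U" "w \<noteq> 1\<^sub>m 2"
    using inf by (metis finite.simps finite_subset subsetI singletonI)
  define a b c where "a = w $$ (0,0) - 1" and "b = w $$ (0,1)" and "c = w $$ (1,0)"
  have w_ind: "w $$ (0,0) = 1 + a" "w $$ (0,1) = b" "w $$ (1,0) = c" "w $$ (1,1) = 1 - a"
    using unipotent_mat_2(1)[OF uni[OF w(1)]] unfolding a_def b_def c_def by (auto simp: algebra_simps)
  have abc: "a * a + b * c = 0"
    using unipotent_mat_2(2)[OF uni[OF w(1)]] unfolding w_ind add_eq_0_iff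
    by (simp add: algebra_simps)
  have bc: "b \<noteq> 0 \<or> c \<noteq> 0"
  proof (rule ccontr)
    assume "\<not> (b \<noteq> 0 \<or> c \<noteq> 0)"
    moreover from this abc have "a = 0" by simp
    ultimately have "w = 1\<^sub>m 2"
      using car[OF w(1)] w_ind by (intro eq_mat_2I) auto
    then show False using w(2) by blast
  qed
  \<comment> \<open>\<open>W s\<close> is 1 + sA. It is additive in s because A^2 = 0, which is the
    relation \<open>abc\<close>.\<close>
  define W where "W s = mat 2 2 (\<lambda>(i, j). if i = j then (if i = 0 then 1 + s * a else 1 - s * a)
    else if i = 0 then s * b else s * c)" for s
  have W_car: "W s \<in> carrier_mat 2 2" for s unfolding W_def by simp
  have W_ind: "W s $$ (0,0) = 1 + s * a" "W s $$ (0,1) = s * b" "W s $$ (1,0) = s * c"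
    "W s $$ (1,1) = 1 - s * a" for s unfolding W_def by simp_all
  have aa: "a * a = - (b * c)" using abc by (simp add: eq_neg_iff_add_eq_0)
  have W_mult: "W s * W t = W (s + t)" for s t
  proof -
    have "s * a * (t * a) = - (s * b * (t * c))" "s * a * (t * a) = - (s * c * (t * b))"
      using arg_cong[OF aa, of "\<lambda>z. s * t * z"] by (simp_all add: algebra_simps)
    then show ?thesis
      using W_car
      by (intro eq_mat_2I) (simp_all add: mult_mat_2_index mult_carrier_mat[of _ 2 2] W_ind algebra_simps
          del: One_nat_def index_mult_mat)
  qed
  have U_W: "\<exists>s. u = W s" if u: "u \<in> U" for u
  proof -
    define \<alpha> \<beta> \<gamma> where "\<alpha> = u $$ (0,0) - 1" and "\<beta> = u $$ (0,1)" and "\<gamma> = u $$ (1,0)"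
    have u_ind: "u $$ (0,0) = 1 + \<alpha>" "u $$ (0,1) = \<beta>" "u $$ (1,0) = \<gamma>" "u $$ (1,1) = 1 - \<alpha>"
      using unipotent_mat_2(1)[OF uni[OF u]] unfolding \<alpha>_def \<beta>_def \<gamma>_def by (auto simp: algebra_simps)
    have e1: "\<alpha> * \<alpha> + \<beta> * \<gamma> = 0"
      using unipotent_mat_2(2)[OF uni[OF u]] unfolding u_ind add_eq_0_iff
      by (simp add: algebra_simps)
    \<comment> \<open>This is tr(AB) = 0, read off from the trace 2 of the unipotent product of w
      and u.\<close>
    have e2: "2 * a * \<alpha> + b * \<gamma> + c * \<beta> = 0"
    proof -
      have "(1 + a) * (1 + \<alpha>) + b * \<gamma> + (c * \<beta> + (1 - a) * (1 - \<alpha>)) = 2"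
        using unipotent_mat_2(1)[OF uni[OF multU[OF w(1) u]]] car[OF w(1)] car[OF u]
        by (simp add: mult_mat_2_index u_ind w_ind del: One_nat_def index_mult_mat)
      moreover have "(1 + a) * (1 + \<alpha>) + b * \<gamma> + (c * \<beta> + (1 - a) * (1 - \<alpha>))
        = 2 + (2 * a * \<alpha> + b * \<gamma> + c * \<beta>)"
        by (simp add: algebra_simps)
      ultimately show ?thesis by simp
    qed
    obtain s where s: "\<alpha> = s * a" "\<beta> = s * b" "\<gamma> = s * c"
    proof (cases "c = 0")
      case True
      then have "a = 0" "b \<noteq> 0" using abc bc by auto
      moreover from this True e2 have "\<gamma> = 0" by simp
      moreover from this e1 have "\<alpha> = 0" by simp
      ultimately show ?thesis using True by (intro that[of "\<beta> / b"]) auto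
    next
      case False
      \<comment> \<open>A combination of det B = 0, tr(AB) = 0 and det A = 0. Nothing is divided by
        2, so characteristic 2 is included.\<close>
      have "(c * \<alpha> - a * \<gamma>) * (c * \<alpha> - a * \<gamma>) = c * c * (\<alpha> * \<alpha> + \<beta> * \<gamma>)
          - c * \<gamma> * (2 * a * \<alpha> + b * \<gamma> + c * \<beta>) + \<gamma> * \<gamma> * (a * a + b * c)"
        by (simp add: algebra_simps)
      also have "\<dots> = 0" unfolding e1 e2 abc by simp
      finally have "(c * \<alpha> - a * \<gamma>) * (c * \<alpha> - a * \<gamma>) = 0" .
      then have \<alpha>: "c * \<alpha> = a * \<gamma>" by simp
      have "c * (c * \<beta> - b * \<gamma>) = c * (2 * a * \<alpha> + b * \<gamma> + c * \<beta>)
          - 2 * a * (c * \<alpha> - a * \<gamma>) - 2 * \<gamma> * (a * a + b * c)"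
        by (simp add: algebra_simps)
      also have "\<dots> = 0" unfolding e2 abc \<alpha> by simp
      finally have "c * \<beta> = b * \<gamma>" using False by simp
      with \<alpha> False show ?thesis by (intro that[of "\<gamma> / c"]) (auto simp: field_simps)
    qed
    then have "u = W s" using car[OF u] W_car u_ind W_ind by (intro eq_mat_2I) auto
    then show ?thesis by blast
  qed
  define T where "T = {s. W s \<in> U}"
  have "U \<subseteq> W ` T" using U_W unfolding T_def by blast
  then have "infinite T" using inf by (meson finite_imageI finite_subset)
  moreover have "0 \<in> T"
  proof -
    have "W 0 = 1\<^sub>m 2" using W_car[of 0] by (intro eq_mat_2I) (auto simp: W_def)
    then show ?thesis using oneU unfolding T_def by simp
  qed
  moreover have "s + t \<in> T" if "s \<in> T" "t \<in> T" for s t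
    using multU[of "W s" "W t"] that unfolding T_def by (simp add: W_mult)
  \<comment> \<open>The columns of h are A x and x for a basis vector x outside the kernel of A: the
    second one if c = 0, the first one otherwise. In this basis A becomes a single Jordan
    block.\<close>
  moreover obtain h where h: "h \<in> carrier_mat 2 2" "det h \<noteq> 0" "\<And>s. W s * h = h * unip s"
  proof (cases "c = 0")
    case True
    then have ab: "a = 0" "b \<noteq> 0" using abc bc by auto
    define h where "h = mat 2 2 (\<lambda>(i :: nat, j :: nat). if i \<noteq> j then 0 else if i = 0 then b else 1)"
    have hc: "h \<in> carrier_mat 2 2" unfolding h_def by simp
    have h_ind: "h $$ (0,0) = b" "h $$ (0,1) = 0" "h $$ (1,0) = 0" "h $$ (1,1) = 1"
      unfolding h_def by simp_all
    have "W s * h = h * unip s" for s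
      using hc W_car True ab
      by (intro eq_mat_2I) (simp_all add: mult_mat_2_index mult_carrier_mat[of _ 2 2] W_ind h_ind
          unip_index algebra_simps del: One_nat_def index_mult_mat)
    then show ?thesis using hc ab by (intro that[of h]) (auto simp: det_mat_2 h_ind simp del: One_nat_def)
  next
    case False
    define h where "h = mat 2 2 (\<lambda>(i :: nat, j :: nat). if j = 0 then (if i = 0 then a else c) else if i = 0 then 1 else 0)"
    have hc: "h \<in> carrier_mat 2 2" unfolding h_def by simp
    have h_ind: "h $$ (0,0) = a" "h $$ (0,1) = 1" "h $$ (1,0) = c" "h $$ (1,1) = 0"
      unfolding h_def by simp_all
    have rel: "a * (a * s) + b * (c * s) = 0" for s
      using arg_cong[OF abc, of "\<lambda>z. z * s"] by (simp add: algebra_simps)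
    have "W s * h = h * unip s" for s
      using hc W_car rel[of s]
      by (intro eq_mat_2I) (simp_all add: mult_mat_2_index mult_carrier_mat[of _ 2 2] W_ind h_ind
          unip_index algebra_simps del: One_nat_def index_mult_mat)
    then show ?thesis using hc False by (intro that[of h]) (auto simp: det_mat_2 h_ind simp del: One_nat_def)
  qed
  moreover have "\<exists>u\<in>U. u * h = h * unip t" if "t \<in> T" for t
    using that h(3) unfolding T_def by blast
  ultimately show ?thesis using that by blast
qed

section \<open>Unboundedness of the delta number\<close>

theorem theorem1p4:
  fixes G U :: "'k::alg_closed_field mat set" and p :: nat
  assumes "CHAR('k) = p" and "p > 0"
    and "closed_subgroup_GL 2 G"
    and "unipotent_subgroup_GL 2 U" and "infinite U" and "U \<subseteq> G"
  shows "delta 2 G = \<infinity>"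
proof -
  have G: "subgroup G (GL 2)" using assms(3) unfolding closed_subgroup_GL_def by blast
  then have Gsub: "G \<subseteq> carrier (GL 2)" by (rule subgroup.subset)
  have char: "CHAR('k) > 0" using assms by simp
  obtain h T where h: "h \<in> carrier_mat 2 2" "det h \<noteq> 0"
    and T: "infinite T" "0 \<in> T" "\<And>s t. s \<in> T \<Longrightarrow> t \<in> T \<Longrightarrow> s + t \<in> T"
    and conj: "\<And>t. t \<in> T \<Longrightarrow> \<exists>u\<in>U. u * h = h * unip t"
    using unipotent_subgroup_conj_unip[OF assms(4,5)] by blast
  have "enat n \<le> delta 2 G" for n
  proof -
    obtain E where E: "finite E" "E \<subseteq> T" "n < card E" "\<And>s t. s \<in> E \<Longrightarrow> t \<in> E \<Longrightarrow> s + t \<in> E"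
      using finite_additive_subset_card_ge[OF char T] by blast
    \<comment> \<open>Forms of degree N span a space of dimension N + 1, which has to equal the
      number of points of E.\<close>
    obtain N where N: "card E = Suc N" using E(3) by (metis less_imp_Suc_add)
    let ?n = "Suc N * Suc N" and ?v = "vec_of_mat (Suc N) (1\<^sub>m (Suc N)) :: 'k vec"
    have conjE: "\<exists>u\<in>G. u * h = h * unip t" if "t \<in> E" for t
      using conj that E(2) assms(6) by blast
    have "n \<le> d" if d: "delta_set 2 G ?n (conj_rep N) (invariants_le 2 G ?n (conj_rep N) d)" for d
    proof (rule ccontr)
      assume "\<not> n \<le> d"
      then have "d < card E" using E(3) by simp
      have "?v \<in> fixed_vecs G ?n (conj_rep N) - nullcone 2 G ?n (conj_rep N)"
        using conj_rep_fixes_one[OF Gsub] one_notin_nullcone[OF G] by blast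
      then obtain f where f: "f \<in> plus_part ?n (invariants_le 2 G ?n (conj_rep N) d)" "f ?v \<noteq> 0"
        using d unfolding delta_set_def by blast
      then have f': "f \<in> invariants_le 2 G ?n (conj_rep N) d" "f (0\<^sub>v ?n) = 0"
        unfolding plus_part_def by blast+
      have "f ?v = 0"
        by (rule low_degree_invariant_one_eq_0[OF char G h E(1) N E(4) conjE f'(1) \<open>d < card E\<close> f'(2)])
      then show False using f(2) by blast
    qed
    then have "enat n \<le> delta_module 2 G ?n (conj_rep N)"
      unfolding delta_module_def by (intro Inf_greatest) auto
    also have "\<dots> \<le> delta 2 G"
      unfolding delta_def using G_module_conj_rep[OF Gsub] by (intro Sup_upper) blast
    finally show ?thesis .
  qed
  \<comment> \<open>A finite value m would contradict the bound for n = m + 1.\<close>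
  then show ?thesis
    by (metis enat_ord_simps(1) not_infinity_eq Suc_n_not_le_n)
qed

end
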